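(* Let $\phi:\mathbb{C}^d\to\mathbb{C}$ be an entire function such that $$SF(z)=\int_{\mathbb{C}^d}F(w)\,e^{\pi z\overline{w}}\,\phi(\overline{w}-z)\,e^{-\pi|w|^2}\,dw$$ defines an operator $S:\mathcal{F}^1(\mathbb{C}^d)\to\mathcal{F}^\infty(\mathbb{C}^d)$. If there exists $H\in L^1(\mathbb{C}^d)$ such that $$\big|\phi(\overline{z}-w)\big|\le\big|e^{\pi(|z|^2+|w|^2)/2-\pi w\overline{z}}\big|\cdot H(z-w)\qquad\text{for all }z,w\in\mathbb{C}^d,$$ then $S$ is bounded on $\mathcal{F}^p(\mathbb{C}^d)$ for all $1\le p\le\infty$.
   Context: For $x,y\in\mathbb{C}^d$ write $xy=\sum_jx_jy_j$ and $|w|^2=w\overline{w}$; $dw$ is Lebesgue measure on $\mathbb{C}^d\cong\mathbb{R}^{2d}$. For $1\le p\le\infty$, the Sobolev-Fock space $\mathcal{F}^p(\mathbb{C}^d)$ is the space of entire functions $F$ on $\mathbb{C}^d$ such that $z\mapsto F(z)e^{-\pi|z|^2/2}$ is in $L^p(\mathbb{C}^d)$, normed by the $L^p$ norm of this function. "Bounded on $\mathcal{F}^p$" means that the integral formula defines (or extends from $\mathcal{F}^1$ to) a bounded operator $\mathcal{F}^p\to\mathcal{F}^p$. *)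

theory Defs
  imports "HOL-Analysis.Analysis" "HOL-Probability.Essential_Supremum"
begin

text \<open>
  The library type \<^typ>\<open>complex ^ 'n\<close> is the space of \<open>d\<close>-tuples of complex numbers,
  \<open>d = CARD('n)\<close>; its norm is the Hermitian norm, and \<^term>\<open>lebesgue\<close> on it is Lebesgue
  measure on the underlying real space of dimension \<open>2 * CARD('n)\<close>.
\<close>

text \<open>The bilinear (not sesquilinear) product \<open>xy\<close>.\<close>

definition cprod :: "complex ^ 'n \<Rightarrow> complex ^ 'n \<Rightarrow> complex" (infixl "\<otimes>\<^sub>c" 70) where
  "x \<otimes>\<^sub>c y = (\<Sum>j\<in>UNIV. x $ j * y $ j)"

definition vcnj :: "complex ^ 'n \<Rightarrow> complex ^ 'n" where
  "vcnj w = (\<chi> j. cnj (w $ j))"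

lemma cprod_vcnj_self: "w \<otimes>\<^sub>c vcnj w = complex_of_real ((norm w)\<^sup>2)"
proof -
  have "(norm w)\<^sup>2 = (\<Sum>j\<in>UNIV. (cmod (w $ j))\<^sup>2)"
    by (simp add: norm_vec_def L2_set_def sum_nonneg)
  then show ?thesis
    by (simp add: cprod_def vcnj_def complex_norm_square del: of_real_power)
qed

text \<open>
  Holomorphy in several variables: at every point the real Frechet derivative exists and is
  complex linear, i.e. of the form \<open>h \<mapsto> ah\<close> for a gradient vector \<open>a\<close>.
\<close>

definition entire :: "(complex ^ 'n \<Rightarrow> complex) \<Rightarrow> bool" where
  "entire F \<longleftrightarrow> (\<forall>z. \<exists>a. (F has_derivative (\<lambda>h. a \<otimes>\<^sub>c h)) (at z))"

text \<open>The exponent ranges over \<^typ>\<open>ennreal\<close>, so that \<open>p = \<infinity>\<close> is included.\<close>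

definition Lp_space :: "ennreal \<Rightarrow> (complex ^ 'n \<Rightarrow> complex) set" where
  "Lp_space p = {f \<in> borel_measurable lebesgue.
     if p = \<infinity> then esssup lebesgue (\<lambda>x. ennreal (norm (f x))) < \<infinity>
     else integrable lebesgue (\<lambda>x. norm (f x) powr enn2real p)}"

definition Lp_norm :: "ennreal \<Rightarrow> (complex ^ 'n \<Rightarrow> complex) \<Rightarrow> real" where
  "Lp_norm p f =
     (if p = \<infinity> then enn2real (esssup lebesgue (\<lambda>x. ennreal (norm (f x))))
      else (LINT x|lebesgue. norm (f x) powr enn2real p) powr (1 / enn2real p))"

definition fock_weighted :: "(complex ^ 'n \<Rightarrow> complex) \<Rightarrow> complex ^ 'n \<Rightarrow> complex" where
  "fock_weighted F z = F z * of_real (exp (- pi * (norm z)\<^sup>2 / 2))"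

definition fock_space :: "ennreal \<Rightarrow> (complex ^ 'n \<Rightarrow> complex) set" where
  "fock_space p = {F. entire F \<and> fock_weighted F \<in> Lp_space p}"

definition fock_norm :: "ennreal \<Rightarrow> (complex ^ 'n \<Rightarrow> complex) \<Rightarrow> real" where
  "fock_norm p F = Lp_norm p (fock_weighted F)"

definition fock_integrand ::
  "(complex ^ 'n \<Rightarrow> complex) \<Rightarrow> (complex ^ 'n \<Rightarrow> complex) \<Rightarrow> complex ^ 'n \<Rightarrow> complex ^ 'n \<Rightarrow> complex"
where
  "fock_integrand \<phi> F z w =
     F w * exp (of_real pi * (z \<otimes>\<^sub>c vcnj w)) * \<phi> (vcnj w - z) * of_real (exp (- pi * (norm w)\<^sup>2))"

definition fock_op ::
  "(complex ^ 'n \<Rightarrow> complex) \<Rightarrow> (complex ^ 'n \<Rightarrow> complex) \<Rightarrow> complex ^ 'n \<Rightarrow> complex"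
where
  "fock_op \<phi> F z = (LINT w|lebesgue. fock_integrand \<phi> F z w)"

text \<open>
  The integral formula defines an operator from \<open>fock_space p\<close> to \<open>fock_space q\<close>. The integrals
  are required to converge absolutely, since the Bochner integral of a non-integrable function
  is 0 by convention; linearity in \<open>F\<close> is then automatic. Boundedness is not part of the notion.
\<close>

definition defines_fock_operator ::
  "(complex ^ 'n \<Rightarrow> complex) \<Rightarrow> ennreal \<Rightarrow> ennreal \<Rightarrow> bool"
where
  "defines_fock_operator \<phi> p q \<longleftrightarrow>
     (\<forall>F\<in>fock_space p.
        (\<forall>z. integrable lebesgue (fock_integrand \<phi> F z)) \<and> fock_op \<phi> F \<in> fock_space q)"

definition bounded_on_fock :: "(complex ^ 'n \<Rightarrow> complex) \<Rightarrow> ennreal \<Rightarrow> bool" where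
  "bounded_on_fock \<phi> p \<longleftrightarrow>
     defines_fock_operator \<phi> p p \<and>
     (\<exists>C. \<forall>F\<in>fock_space p. fock_norm p (fock_op \<phi> F) \<le> C * fock_norm p F)"

end

theory Submission
  imports Defs "HOL-Complex_Analysis.Complex_Analysis" "HOL-Probability.Distributions"
begin

text \<open>
  Write \<open>f\<close> for the weighted function \<open>fock_weighted F\<close>. The real part of
  \<open>(|z|\<^sup>2 + |w|\<^sup>2) / 2 - z (vcnj w)\<close> is \<open>|w - z|\<^sup>2 / 2\<close>. Hence, after the Gaussian weights are moved to both
  sides, the operator has a kernel of modulus \<open>K z w = |\<phi> (vcnj w - z)| exp (- \<pi> |w - z|\<^sup>2 / 2)\<close>, and the
  hypothesis on \<open>\<phi>\<close> says precisely that \<open>K z w \<le> H (w - z)\<close>. The weighted image of \<open>F\<close> is therefore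
  dominated by the convolution-like integral of \<open>|f w| K z w\<close>, all row and column integrals of \<open>K\<close> are at
  most the integral of \<open>H\<close>, and Schur's test (\<open>schur_test\<close>, \<open>Lp_space_infinity_dominated\<close>) gives the norm
  estimate on \<open>L\<^sup>p\<close> for all \<open>p\<close>.

  Two points concern the functions themselves and not only their norms. The integral must converge for
  every \<open>z\<close>. This holds because the functions of \<open>\<F>\<^sup>p\<close> are bounded after weighting
  (\<open>fock_space_bounded\<close>). That follows from a mean value inequality over balls, which is reduced to the mean value
  property on circles in complex lines by the invariance of Lebesgue measure under the rotations
  \<open>w \<mapsto> cis \<theta> *s w\<close>.

  Moreover, the image of \<open>F\<close> must be entire (\<open>fock_op_entire\<close>). For \<open>F\<close> in \<open>\<F>\<^sup>1\<close> this is part of the hypothesis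
  that the operator maps \<open>\<F>\<^sup>1\<close> to \<open>\<F>\<^sup>\<infinity>\<close>. In general \<open>F\<close> is approximated by its dilates \<open>F (r w)\<close> with \<open>r < 1\<close>,
  which lie in \<open>\<F>\<^sup>1\<close>; the images of the dilates converge locally uniformly, and locally uniform limits of
  entire functions are entire (\<open>entire_locally_uniform_limit\<close>).
\<close>

section \<open>The bilinear product and entire functions\<close>

lemma cprod_add_left: "(x + y) \<otimes>\<^sub>c z = x \<otimes>\<^sub>c z + y \<otimes>\<^sub>c z"
  and cprod_add_right: "z \<otimes>\<^sub>c (x + y) = z \<otimes>\<^sub>c x + z \<otimes>\<^sub>c y"
  and cprod_diff_left: "(x - y) \<otimes>\<^sub>c z = x \<otimes>\<^sub>c z - y \<otimes>\<^sub>c z"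
  and cprod_scale_left: "(c *s x) \<otimes>\<^sub>c z = c * (x \<otimes>\<^sub>c z)"
  and cprod_scale_right: "z \<otimes>\<^sub>c (c *s x) = c * (z \<otimes>\<^sub>c x)"
  and cprod_scaleR_left: "(r *\<^sub>R x) \<otimes>\<^sub>c z = of_real r * (x \<otimes>\<^sub>c z)"
  and cprod_scaleR_right: "z \<otimes>\<^sub>c (r *\<^sub>R x) = of_real r * (z \<otimes>\<^sub>c x)"
  by (simp_all add: cprod_def algebra_simps sum.distrib sum_subtractf sum_distrib_left scaleR_conv_of_real[where 'a = complex])

lemma cprod_axis: "a \<otimes>\<^sub>c axis j 1 = a $ j"
  unfolding cprod_def axis_def by (simp add: if_distrib cong: if_cong)

lemma cprod_vcnj_commute: "w \<otimes>\<^sub>c vcnj z = cnj (z \<otimes>\<^sub>c vcnj w)"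
  by (simp add: cprod_def vcnj_def mult.commute)

text \<open>
  Completing the square: with this identity and its variant for differences, products of Gaussian weights
  and the exponential of \<open>z \<otimes>\<^sub>c vcnj w\<close> become Gaussians of \<open>z + w\<close> and \<open>w - z\<close>.
\<close>

lemma norm_add_sq_cprod:
  "(norm (z + w))\<^sup>2 = (norm z)\<^sup>2 + (norm w)\<^sup>2 + 2 * Re (z \<otimes>\<^sub>c vcnj w)"
proof -
  have "vcnj (z + w) = vcnj z + vcnj w"
    by (simp add: vcnj_def vec_eq_iff)
  then have "(z + w) \<otimes>\<^sub>c vcnj (z + w)
      = z \<otimes>\<^sub>c vcnj z + w \<otimes>\<^sub>c vcnj w + (z \<otimes>\<^sub>c vcnj w + cnj (z \<otimes>\<^sub>c vcnj w))"
    by (simp add: cprod_add_left cprod_add_right flip: cprod_vcnj_commute)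
  then have "complex_of_real ((norm (z + w))\<^sup>2)
      = complex_of_real ((norm z)\<^sup>2 + (norm w)\<^sup>2 + 2 * Re (z \<otimes>\<^sub>c vcnj w))"
    by (simp only: cprod_vcnj_self complex_add_cnj of_real_add)
  then show ?thesis
    by (simp only: of_real_eq_iff)
qed

lemma norm_diff_sq_cprod:
  "(norm (w - z))\<^sup>2 = (norm z)\<^sup>2 + (norm w)\<^sup>2 - 2 * Re (z \<otimes>\<^sub>c vcnj w)"
proof -
  have "(- z) \<otimes>\<^sub>c vcnj w = - (z \<otimes>\<^sub>c vcnj w)"
    using cprod_scale_left[of "-1" z "vcnj w"] by simp
  then show ?thesis
    using norm_add_sq_cprod[of "- z" w] by simp
qed

lemma norm_cscale: "norm (c *s w) = cmod c * norm (w :: complex ^ 'n)"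
  by (simp add: norm_vec_def norm_mult L2_set_right_distrib)

lemma cscale_linear: "linear (\<lambda>w :: complex ^ 'n. c *s w)"
  by (rule linearI) (simp_all add: vec_eq_iff algebra_simps)

lemma continuous_on_cprod [continuous_intros]:
  assumes "continuous_on S f" "continuous_on S g"
  shows "continuous_on S (\<lambda>x. f x \<otimes>\<^sub>c g x)"
  unfolding cprod_def by (intro continuous_intros assms)

lemma continuous_on_vcnj [continuous_intros]:
  assumes "continuous_on S f"
  shows "continuous_on S (\<lambda>x. vcnj (f x))"
  unfolding vcnj_def by (intro continuous_intros assms)

lemma continuous_on_cscale [continuous_intros]:
  assumes "continuous_on S f" "continuous_on S g"
  shows "continuous_on S (\<lambda>x. f x *s (g x :: complex ^ 'n))"
  unfolding vector_scalar_mult_def by (intro continuous_intros assms)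

lemma entire_continuous:
  assumes "entire F"
  shows "continuous_on UNIV F"
  using assms has_derivative_continuous
  by (fastforce simp: entire_def continuous_on_eq_continuous_at)

text \<open>
  The restriction of an entire function to a complex line is an entire function of one variable.
  All results of several complex variables below come from one-variable theorems by this route.
\<close>

lemma entire_along_line:
  assumes "(F has_derivative (\<lambda>h. a \<otimes>\<^sub>c h)) (at (z + t *s u))"
  shows "((\<lambda>t. F (z + t *s u)) has_field_derivative (a \<otimes>\<^sub>c u)) (at t)"
proof -
  have "bounded_linear (\<lambda>t. t *s u)"
    by (intro linear_conv_bounded_linear[THEN iffD1] linearI) (simp_all add: vec_eq_iff algebra_simps)
  then have "((\<lambda>t. z + t *s u) has_derivative (\<lambda>s. s *s u)) (at t)"
    by (auto intro!: derivative_eq_intros bounded_linear_imp_has_derivative)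
  from diff_chain_at[OF this assms] show ?thesis
    by (simp add: has_field_derivative_def o_def cprod_scale_right mult_commute_abs)
qed

lemma entire_line_holomorphic:
  assumes "entire F"
  shows "(\<lambda>t. F (z + t *s u)) holomorphic_on S"
proof -
  have "\<exists>D. ((\<lambda>t. F (z + t *s u)) has_field_derivative D) (at t within S)" for t
  proof -
    obtain a where "(F has_derivative (\<lambda>h. a \<otimes>\<^sub>c h)) (at (z + t *s u))"
      using assms by (auto simp: entire_def)
    from has_field_derivative_at_within[OF entire_along_line[OF this]] show ?thesis
      by blast
  qed
  then show ?thesis
    by (simp add: holomorphic_on_def field_differentiable_def)
qed

lemma entire_dilation:
  assumes "entire F"
  shows "entire (\<lambda>z. F (r *\<^sub>R z))"
  unfolding entire_def
proof
  fix z
  obtain a where a: "(F has_derivative (\<lambda>h. a \<otimes>\<^sub>c h)) (at (r *\<^sub>R z))"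
    using assms by (auto simp: entire_def)
  have "((\<lambda>z. r *\<^sub>R z) has_derivative (\<lambda>h. r *\<^sub>R h)) (at z)"
    by (auto intro!: derivative_eq_intros)
  from diff_chain_at[OF this a]
  have "((\<lambda>z. F (r *\<^sub>R z)) has_derivative (\<lambda>h. (r *\<^sub>R a) \<otimes>\<^sub>c h)) (at z)"
    by (simp add: o_def cprod_scaleR_right cprod_scaleR_left)
  then show "\<exists>a. ((\<lambda>z. F (r *\<^sub>R z)) has_derivative (\<lambda>h. a \<otimes>\<^sub>c h)) (at z)"
    by blast
qed

text \<open>
  Cauchy's estimate for the derivative on the disc of radius \<open>1 / norm h\<close> in the complex line through \<open>z\<close>
  in direction \<open>h\<close>; this disc is mapped into the unit ball around \<open>z\<close>.
\<close>

lemma entire_gradient_bound: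
  assumes "entire F" "(F has_derivative (\<lambda>h. a \<otimes>\<^sub>c h)) (at z)"
    and B: "\<And>x. norm x \<le> 1 \<Longrightarrow> cmod (F (z + x)) \<le> B"
  shows "cmod (a \<otimes>\<^sub>c h) \<le> B * norm h"
proof (cases "h = 0")
  case True
  then show ?thesis
    by (simp add: cprod_def)
next
  case False
  define \<rho> where "\<rho> = 1 / norm h"
  have \<rho>: "0 < \<rho>"
    using False by (simp add: \<rho>_def)
  let ?f = "\<lambda>t. F (z + t *s h)"
  have hol: "?f holomorphic_on S" for S
    by (rule entire_line_holomorphic) fact
  have "cmod ((deriv ^^ 1) ?f 0) \<le> fact 1 * B / \<rho> ^ 1"
  proof (rule Cauchy_inequality)
    show "cmod (?f t) \<le> B" if "cmod (0 - t) = \<rho>" for t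
      using that False by (intro B) (simp add: norm_cscale \<rho>_def)
  qed (use hol \<rho> holomorphic_on_imp_continuous_on in auto)
  moreover have "deriv ?f 0 = a \<otimes>\<^sub>c h"
    by (rule DERIV_imp_deriv, rule entire_along_line) (use assms(2) in simp)
  ultimately show ?thesis
    by (simp add: \<rho>_def)
qed

lemma norm_axis_complex: "norm (axis j 1 :: complex ^ 'n) = 1"
proof -
  have "axis j 1 \<bullet> (axis j 1 :: complex ^ 'n) = 1"
    unfolding inner_axis_axis by simp
  then show ?thesis
    by (rule norm_eq_1[THEN iffD2])
qed

text \<open>
  Weierstrass' convergence theorem in several variables. By \<open>entire_gradient_bound\<close> the derivatives
  form a uniform Cauchy sequence on each ball, and a sequence with uniformly convergent derivatives may be
  differentiated term by term. The gradient of the limit is the coordinatewise limit of the gradients, so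
  that the derivative of the limit is complex linear again.
\<close>

lemma entire_locally_uniform_limit:
  fixes G :: "nat \<Rightarrow> complex ^ 'n \<Rightarrow> complex"
  assumes ent: "\<And>n. entire (G n)"
    and lim: "\<And>R e. 0 < e \<Longrightarrow> \<forall>\<^sub>F n in sequentially. \<forall>z\<in>cball 0 R. cmod (G n z - g z) \<le> e"
  shows "entire g"
  unfolding entire_def
proof
  fix z0 :: "complex ^ 'n"
  have "\<forall>n z. \<exists>a. (G n has_derivative (\<lambda>h. a \<otimes>\<^sub>c h)) (at z)"
    using ent by (simp add: entire_def)
  then obtain a where "\<forall>n z. (G n has_derivative (\<lambda>h. a n z \<otimes>\<^sub>c h)) (at z)"
    by (auto simp only: choice_iff)
  then have a: "(G n has_derivative (\<lambda>h. a n z \<otimes>\<^sub>c h)) (at z)" for n z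
    by simp
  define R where "R = norm z0 + 1"
  have pointwise: "(\<lambda>n. G n z) \<longlonglongrightarrow> g z" for z
    unfolding tendsto_iff
  proof (intro allI impI)
    fix e :: real
    assume "0 < e"
    then have "\<forall>\<^sub>F n in sequentially. \<forall>x\<in>cball 0 (norm z). cmod (G n x - g x) \<le> e / 2"
      by (intro lim) simp
    then show "\<forall>\<^sub>F n in sequentially. dist (G n z) (g z) < e"
    proof eventually_elim
      case (elim n)
      then have "cmod (G n z - g z) \<le> e / 2"
        by simp
      then show ?case
        using \<open>0 < e\<close> by (simp add: dist_norm)
    qed
  qed
  have cauchy: "\<exists>N. \<forall>m\<ge>N. \<forall>n\<ge>N. \<forall>z\<in>ball 0 R. \<forall>h. cmod (a m z \<otimes>\<^sub>c h - a n z \<otimes>\<^sub>c h) \<le> e * norm h"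
    if e: "0 < e" for e
  proof -
    have "\<exists>N. \<forall>n\<ge>N. \<forall>z\<in>cball 0 (R + 1). cmod (G n z - g z) \<le> e / 2"
      using lim[OF half_gt_zero[OF e], of "R + 1"] unfolding eventually_sequentially .
    then obtain N where N: "\<forall>n\<ge>N. \<forall>z\<in>cball 0 (R + 1). cmod (G n z - g z) \<le> e / 2" ..
    have "cmod (a m z \<otimes>\<^sub>c h - a n z \<otimes>\<^sub>c h) \<le> e * norm h"
      if mn: "N \<le> m" "N \<le> n" and z: "z \<in> ball 0 R" for m n z h
    proof -
      have der: "((\<lambda>x. G m x - G n x) has_derivative (\<lambda>h. (a m x - a n x) \<otimes>\<^sub>c h)) (at x)" for x
        unfolding cprod_diff_left by (intro has_derivative_diff a)
      have "cmod ((a m z - a n z) \<otimes>\<^sub>c h) \<le> e * norm h"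
      proof (rule entire_gradient_bound[OF _ der])
        show "entire (\<lambda>x. G m x - G n x)"
          unfolding entire_def using der by blast
        fix x :: "complex ^ 'n"
        assume "norm x \<le> 1"
        then have "z + x \<in> cball 0 (R + 1)"
          using z norm_triangle_ineq[of z x] by simp
        from N[rule_format, OF mn(1) this] N[rule_format, OF mn(2) this]
        show "cmod (G m (z + x) - G n (z + x)) \<le> e"
          using norm_triangle_ineq4[of "G m (z + x) - g (z + x)" "G n (z + x) - g (z + x)"] by simp
      qed
      then show ?thesis
        by (simp add: cprod_diff_left)
    qed
    then show ?thesis
      by (intro exI[of _ N] allI impI ballI)
  qed
  have "convergent (\<lambda>n. a n z $ j)" if z: "z \<in> ball 0 R" for z j
  proof -
    have "Cauchy (\<lambda>n. a n z $ j)"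
      unfolding Cauchy_def dist_norm
    proof (intro allI impI)
      fix e :: real
      assume "0 < e"
      from cauchy[OF half_gt_zero[OF this]] obtain N where
        N: "\<forall>m\<ge>N. \<forall>n\<ge>N. \<forall>z\<in>ball 0 R. \<forall>h. cmod (a m z \<otimes>\<^sub>c h - a n z \<otimes>\<^sub>c h) \<le> e / 2 * norm h" ..
      have "cmod (a m z $ j - a n z $ j) < e" if "N \<le> m" "N \<le> n" for m n
      proof -
        have "cmod (a m z $ j - a n z $ j) \<le> e / 2"
          using N[rule_format, OF that z, of "axis j 1"]
          unfolding cprod_axis norm_axis_complex mult_1_right .
        also have "\<dots> < e"
          using \<open>0 < e\<close> by simp
        finally show ?thesis .
      qed
      then show "\<exists>M. \<forall>m\<ge>M. \<forall>n\<ge>M. cmod (a m z $ j - a n z $ j) < e"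
        by blast
    qed
    then show ?thesis
      by (simp add: Cauchy_convergent_iff)
  qed
  then have b: "(\<lambda>n. a n z $ j) \<longlonglongrightarrow> lim (\<lambda>n. a n z $ j)" if "z \<in> ball 0 R" for z j
    using that by (simp add: convergent_LIMSEQ_iff)
  define A where "A = (\<lambda>z. \<chi> j. lim (\<lambda>n. a n z $ j))"
  have A: "(\<lambda>n. a n z \<otimes>\<^sub>c h) \<longlonglongrightarrow> A z \<otimes>\<^sub>c h" if "z \<in> ball 0 R" for z h
    unfolding cprod_def A_def vec_lambda_beta by (intro tendsto_sum tendsto_mult tendsto_const b that)
  have "\<exists>g'. \<forall>x\<in>ball 0 R. (\<lambda>n. G n x) \<longlonglongrightarrow> g' x \<and> (g' has_derivative (\<lambda>h. A x \<otimes>\<^sub>c h)) (at x within ball 0 R)"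
  proof (rule has_derivative_sequence)
    show "z0 \<in> ball 0 R"
      by (simp add: R_def)
    show "(\<lambda>n. G n z0) \<longlonglongrightarrow> g z0"
      by (rule pointwise)
    show "(G n has_derivative (\<lambda>h. a n x \<otimes>\<^sub>c h)) (at x within ball 0 R)" for n x
      using a has_derivative_at_withinI by blast
    fix e :: real
    assume "0 < e"
    from cauchy[OF this] obtain N where
      N: "\<forall>m\<ge>N. \<forall>n\<ge>N. \<forall>z\<in>ball 0 R. \<forall>h. cmod (a m z \<otimes>\<^sub>c h - a n z \<otimes>\<^sub>c h) \<le> e * norm h" ..
    have "cmod (a n x \<otimes>\<^sub>c h - A x \<otimes>\<^sub>c h) \<le> e * norm h" if "N \<le> n" "x \<in> ball 0 R" for n x h
    proof (rule tendsto_upperbound)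
      show "(\<lambda>m. cmod (a n x \<otimes>\<^sub>c h - a m x \<otimes>\<^sub>c h)) \<longlonglongrightarrow> cmod (a n x \<otimes>\<^sub>c h - A x \<otimes>\<^sub>c h)"
        by (intro tendsto_norm tendsto_diff tendsto_const A that)
      show "\<forall>\<^sub>F m in sequentially. cmod (a n x \<otimes>\<^sub>c h - a m x \<otimes>\<^sub>c h) \<le> e * norm h"
        unfolding eventually_sequentially by (intro exI[of _ N] allI impI N[rule_format] that)
    qed simp
    then show "\<forall>\<^sub>F n in sequentially. \<forall>x\<in>ball 0 R. \<forall>h. cmod (a n x \<otimes>\<^sub>c h - A x \<otimes>\<^sub>c h) \<le> e * norm h"
      unfolding eventually_sequentially by (intro exI[of _ N] allI impI ballI)
  qed simp
  then obtain g' where g': "\<forall>x\<in>ball 0 R. (\<lambda>n. G n x) \<longlonglongrightarrow> g' x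
      \<and> (g' has_derivative (\<lambda>h. A x \<otimes>\<^sub>c h)) (at x within ball 0 R)" ..
  have z0: "z0 \<in> ball 0 R"
    by (simp add: R_def)
  have "(g' has_derivative (\<lambda>h. A z0 \<otimes>\<^sub>c h)) (at z0)"
    using bspec[OF g' z0] unfolding at_within_open[OF z0 open_ball] by (rule conjunct2)
  moreover have "g' x = g x" if "x \<in> ball 0 R" for x
    using bspec[OF g' that, THEN conjunct1] pointwise by (rule LIMSEQ_unique)
  ultimately have "(g has_derivative (\<lambda>h. A z0 \<otimes>\<^sub>c h)) (at z0)"
    by (rule has_derivative_transform_within_open[OF _ open_ball z0])
  then show "\<exists>a. (g has_derivative (\<lambda>h. a \<otimes>\<^sub>c h)) (at z0)"
    by blast
qed

section \<open>Mean values and rotation invariance of Lebesgue measure\<close>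

text \<open>
  Cauchy's integral formula at the centre of the unit circle. The circle is parametrised by
  \<open>{0..1}\<close>, which has measure 1, so that no normalising factor appears.
\<close>

lemma holomorphic_mean_value_le:
  fixes g :: "complex \<Rightarrow> complex"
  assumes "g holomorphic_on UNIV"
  shows "ennreal (cmod (g 0)) \<le> (\<integral>\<^sup>+x. ennreal (cmod (g (cis (2 * pi * x)))) * indicator {0..1} x \<partial>lborel)"
proof -
  define c where "c = (\<lambda>x. g (cis (2 * pi * x)))"
  have cont_g: "continuous_on UNIV g"
    using assms by (rule holomorphic_on_imp_continuous_on)
  have cont: "continuous_on S c" for S
    unfolding c_def cis_conv_exp
    by (intro continuous_intros continuous_on_compose2[OF cont_g]) auto
  have circ0: "((\<lambda>u. g u / (u - 0)) has_contour_integral (2 * of_real pi * \<i> * g 0)) (circlepath 0 1)"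
    by (rule Cauchy_integral_circlepath_simple) (use assms holomorphic_on_subset in auto)
  have circ: "circlepath 0 1 x = cis (2 * pi * x)" for x
    by (simp add: circlepath cis_conv_exp mult_ac)
  have vd: "vector_derivative (circlepath 0 1) (at x within {0..1})
      = 2 * of_real pi * \<i> * cis (2 * pi * x)" if "0 \<le> x" "x \<le> 1" for x
    using that by (simp add: vector_derivative_circlepath01 cis_conv_exp mult_ac)
  from circ0 have "((\<lambda>x. (2 * of_real pi * \<i>) * c x) has_integral (2 * of_real pi * \<i> * g 0)) {0..1}"
    unfolding has_contour_integral_def
    by (rule has_integral_eq[rotated])
       (simp add: c_def vd circ)
  then have *: "(c has_integral g 0) {0..1}"
    by (subst (asm) has_integral_mult_right_iff) simp_all
  have int: "(\<lambda>x. cmod (c x)) integrable_on {0..1}"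
    by (intro integrable_continuous_real continuous_intros cont)
  have "cmod (g 0) \<le> integral {0..1} (\<lambda>x. cmod (c x))"
    using integral_norm_bound_integral[OF has_integral_integrable[OF *] int] * 
    by (simp add: integral_unique)
  also have "ennreal (integral {0..1} (\<lambda>x. cmod (c x)))
      = (\<integral>\<^sup>+x. ennreal (indicator {0..1} x *\<^sub>R cmod (c x)) \<partial>lborel)"
  proof (rule nn_integral_has_integral_lborel[symmetric])
    show "((\<lambda>x. indicator {0..1} x *\<^sub>R cmod (c x)) has_integral integral {0..1} (\<lambda>x. cmod (c x))) UNIV"
    proof -
      have "(\<lambda>x. indicator {0..1} x *\<^sub>R cmod (c x)) = (\<lambda>x. if x \<in> {0..1} then cmod (c x) else 0)"
        by (auto simp: fun_eq_iff)
      then show ?thesis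
        using integrable_integral[OF int] by (simp only: has_integral_restrict_UNIV)
    qed
    show "(\<lambda>x. indicator {0..1} x *\<^sub>R cmod (c x)) \<in> borel_measurable borel"
      by (rule borel_measurable_continuous_on_indicator) (auto intro!: continuous_intros cont)
  qed simp
  also have "\<dots> = (\<integral>\<^sup>+x. ennreal (cmod (c x)) * indicator {0..1} x \<partial>lborel)"
    by (rule nn_integral_cong) (simp split: split_indicator)
  finally show ?thesis
    by (simp add: c_def ennreal_leI)
qed

lemma nn_integral_translate:
  fixes f :: "'a::euclidean_space \<Rightarrow> ennreal"
  assumes [measurable]: "f \<in> borel_measurable borel"
  shows "(\<integral>\<^sup>+x. f (c + x) \<partial>lborel) = (\<integral>\<^sup>+x. f x \<partial>lborel)"
  by (subst (2) lborel_distr_plus[of c, symmetric]) (simp add: nn_integral_distr)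

text \<open>
  A double count with the unit ball \<open>B\<close>. Since \<open>T\<close> is onto, a translation of \<open>y\<close> translates \<open>T y\<close> by
  any prescribed vector. Hence \<open>B x * f (x + T y)\<close> has the double integral \<open>vol B\<close> times the integral
  of \<open>f \<circ> T\<close>. Substituting \<open>x - T y\<close> for \<open>x\<close> first, and then using that \<open>B\<close> is invariant under \<open>T\<close> and
  \<open>- T\<close>, one finds \<open>vol B\<close> times the integral of \<open>f\<close> instead; and \<open>0 < vol B < \<infinity>\<close>.
\<close>

lemma nn_integral_linear_isometry:
  fixes T :: "'a::euclidean_space \<Rightarrow> 'a" and f :: "'a \<Rightarrow> ennreal"
  assumes T: "linear T" "\<And>x. norm (T x) = norm x"
    and [measurable]: "f \<in> borel_measurable borel"
  shows "(\<integral>\<^sup>+x. f (T x) \<partial>lborel) = (\<integral>\<^sup>+x. f x \<partial>lborel)"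
proof -
  define B :: "'a \<Rightarrow> ennreal" where "B = indicator (ball 0 1)"
  have [measurable]: "B \<in> borel_measurable borel"
    unfolding B_def by (intro borel_measurable_indicator) simp
  have B: "B (- T y) = B y" for y
    by (simp add: B_def indicator_def T)
  have [measurable]: "T \<in> borel_measurable borel"
    using T(1) linear_continuous_on linear_conv_bounded_linear
    by (intro borel_measurable_continuous_onI) blast
  have "inj T"
    using T by (metis linear_injective_0 norm_eq_zero)
  then have "surj T"
    using T(1) linear_injective_imp_surjective by blast
  then obtain S where S: "T (S x) = x" for x
    by (metis surjD)
  have shift: "(\<integral>\<^sup>+y. g (x + T y) \<partial>lborel) = (\<integral>\<^sup>+y. g (T y) \<partial>lborel)"
    if [measurable]: "g \<in> borel_measurable borel" for g :: "'a \<Rightarrow> ennreal" and x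
    using nn_integral_translate[of "\<lambda>y. g (T y)" "S x"] by (simp add: linear_add[OF T(1)] S)
  have "(\<integral>\<^sup>+x. B x \<partial>lborel) * (\<integral>\<^sup>+y. f (T y) \<partial>lborel)
      = (\<integral>\<^sup>+x. \<integral>\<^sup>+y. B x * f (x + T y) \<partial>lborel \<partial>lborel)"
    by (simp add: nn_integral_cmult nn_integral_multc shift)
  also have "\<dots> = (\<integral>\<^sup>+y. \<integral>\<^sup>+x. B x * f (x + T y) \<partial>lborel \<partial>lborel)"
    by (rule lborel_pair.Fubini') simp
  also have "\<dots> = (\<integral>\<^sup>+y. \<integral>\<^sup>+x. B (x - T y) * f x \<partial>lborel \<partial>lborel)"
  proof (rule nn_integral_cong)
    fix y
    show "(\<integral>\<^sup>+x. B x * f (x + T y) \<partial>lborel) = (\<integral>\<^sup>+x. B (x - T y) * f x \<partial>lborel)"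
      using nn_integral_translate[of "\<lambda>x. B (x - T y) * f x" "T y"] by (simp add: add.commute)
  qed
  also have "\<dots> = (\<integral>\<^sup>+x. \<integral>\<^sup>+y. B (x - T y) * f x \<partial>lborel \<partial>lborel)"
    by (rule lborel_pair.Fubini') simp
  also have "\<dots> = (\<integral>\<^sup>+x. B x \<partial>lborel) * (\<integral>\<^sup>+x. f x \<partial>lborel)"
  proof -
    have "(\<integral>\<^sup>+y. B (x - T y) \<partial>lborel) = (\<integral>\<^sup>+y. B y \<partial>lborel)" for x
      using shift[of "\<lambda>u. B (- u)" "- x"] by (simp add: B)
    then show ?thesis
      by (simp add: nn_integral_cmult nn_integral_multc)
  qed
  finally have eq: "(\<integral>\<^sup>+x. B x \<partial>lborel) * (\<integral>\<^sup>+y. f (T y) \<partial>lborel)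
      = (\<integral>\<^sup>+x. B x \<partial>lborel) * (\<integral>\<^sup>+x. f x \<partial>lborel)" .
  have "(\<integral>\<^sup>+x. B x \<partial>lborel) \<noteq> 0" "(\<integral>\<^sup>+x. B x \<partial>lborel) \<noteq> \<infinity>"
    using content_ball_pos[of 1 "0::'a"] emeasure_lborel_ball_finite[of "0::'a" 1]
    by (auto simp: B_def measure_def enn2real_positive_iff)
  with eq show ?thesis
    by (simp add: ennreal_mult_cancel_left)
qed

section \<open>Boundedness and dilation of functions in Fock spaces\<close>

lemma fock_weighted_continuous:
  assumes "entire F"
  shows "continuous_on S (fock_weighted F)"
  unfolding fock_weighted_def
  by (intro continuous_intros continuous_on_subset[OF entire_continuous[OF assms]]) auto

text \<open>
  The twisted function \<open>g w = F (z + w) * exp (- \<pi> w (vcnj z))\<close> is entire and, up to the constant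
  \<open>exp (\<pi> |z|\<^sup>2 / 2)\<close> and the factor \<open>exp (\<pi> |w|\<^sup>2 / 2)\<close>, which lies between 1 and \<open>exp (\<pi> / 2)\<close> on the unit
  ball, has the modulus of \<open>fock_weighted F (z + w)\<close>. On each complex line through 0 the modulus at 0
  is at most its mean over the circle of the points \<open>cis \<theta> *s w\<close>. Integrating over \<open>w\<close> in the ball and
  exchanging integrals, the rotation \<open>w \<mapsto> cis \<theta> *s w\<close> disappears, because it preserves both Lebesgue
  measure and the ball.
\<close>

lemma fock_weighted_mean_value:
  fixes F :: "complex ^ 'n \<Rightarrow> complex"
  assumes "entire F"
  shows "ennreal (cmod (fock_weighted F z)) * emeasure lborel (ball z 1)
    \<le> ennreal (exp (pi / 2)) * (\<integral>\<^sup>+w. ennreal (cmod (fock_weighted F w)) * indicator (ball z 1) w \<partial>lborel)"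
proof -
  define g where "g = (\<lambda>w. F (z + w) * exp (- (of_real pi * (w \<otimes>\<^sub>c vcnj z))))"
  have "continuous_on UNIV g"
    unfolding g_def
    by (intro continuous_intros continuous_on_compose2[OF entire_continuous[OF assms]]) auto
  then have cont_g: "continuous_on S (\<lambda>x. g (h x))" if "continuous_on S h" for S and h :: "'b::topological_space \<Rightarrow> _"
    using continuous_on_compose2 that by blast
  have [measurable]: "g \<in> borel_measurable borel"
    by (intro borel_measurable_continuous_onI cont_g continuous_intros)
  have [measurable]: "(\<lambda>p. g (cis (2 * pi * fst p) *s snd p)) \<in> borel_measurable (lborel \<Otimes>\<^sub>M lborel)"
    unfolding lborel_prod measurable_lborel2 cis_conv_exp
    by (intro borel_measurable_continuous_onI cont_g continuous_intros)
  have norm_g: "cmod (g w) = cmod (fock_weighted F (z + w)) * exp (pi * (norm z)\<^sup>2 / 2) * exp (pi * (norm w)\<^sup>2 / 2)" for w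
  proof -
    have "Re (w \<otimes>\<^sub>c vcnj z) = Re (z \<otimes>\<^sub>c vcnj w)"
      by (metis cprod_vcnj_commute complex_cnj(1) cnj.simps(1))
    then show ?thesis
      by (simp add: g_def fock_weighted_def norm_mult norm_divide norm_add_sq_cprod exp_minus field_simps flip: exp_add)
  qed
  define V where "V = emeasure lborel (ball 0 1 :: (complex ^ 'n) set)"
  let ?B = "indicator (ball 0 1) :: complex ^ 'n \<Rightarrow> ennreal"
  have [measurable]: "?B \<in> borel_measurable borel"
    by (intro borel_measurable_indicator) simp
  have "ennreal (cmod (g 0)) * V = (\<integral>\<^sup>+w. ennreal (cmod (g 0)) * ?B w \<partial>lborel)"
    by (simp add: V_def nn_integral_cmult)
  also have "\<dots> \<le> (\<integral>\<^sup>+w. (\<integral>\<^sup>+x. ennreal (cmod (g (cis (2 * pi * x) *s w))) * indicator {0..1} x * ?B w \<partial>lborel) \<partial>lborel)"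
  proof (rule nn_integral_mono)
    fix w :: "complex ^ 'n"
    have "(\<lambda>t. g (t *s w)) holomorphic_on UNIV"
      unfolding g_def cprod_scale_left
      by (intro holomorphic_intros entire_line_holomorphic assms)
    from holomorphic_mean_value_le[OF this]
    have "ennreal (cmod (g 0)) \<le> (\<integral>\<^sup>+x. ennreal (cmod (g (cis (2 * pi * x) *s w))) * indicator {0..1} x \<partial>lborel)"
      by simp
    then show "ennreal (cmod (g 0)) * ?B w
        \<le> (\<integral>\<^sup>+x. ennreal (cmod (g (cis (2 * pi * x) *s w))) * indicator {0..1} x * ?B w \<partial>lborel)"
      by (auto split: split_indicator)
  qed
  also have "\<dots> = (\<integral>\<^sup>+x. (\<integral>\<^sup>+w. ennreal (cmod (g (cis (2 * pi * x) *s w))) * indicator {0..1} x * ?B w \<partial>lborel) \<partial>lborel)"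
    by (rule lborel_pair.Fubini') (simp add: case_prod_beta)
  also have "\<dots> = (\<integral>\<^sup>+x. indicator {0..1::real} x * (\<integral>\<^sup>+w. ennreal (cmod (g w)) * ?B w \<partial>lborel) \<partial>lborel)"
  proof (rule nn_integral_cong)
    fix x :: real
    have "(\<integral>\<^sup>+w. ennreal (cmod (g (cis (2 * pi * x) *s w))) * indicator {0..1} x * ?B w \<partial>lborel)
        = (\<integral>\<^sup>+w. indicator {0..1} x * (ennreal (cmod (g (cis (2 * pi * x) *s w))) * ?B (cis (2 * pi * x) *s w)) \<partial>lborel)"
      by (intro nn_integral_cong) (simp add: norm_cscale indicator_def mult_ac)
    also have "\<dots> = (\<integral>\<^sup>+w. indicator {0..1} x * (ennreal (cmod (g w)) * ?B w) \<partial>lborel)"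
      by (rule nn_integral_linear_isometry) (auto simp: norm_cscale cscale_linear)
    also have "\<dots> = indicator {0..1} x * (\<integral>\<^sup>+w. ennreal (cmod (g w)) * ?B w \<partial>lborel)"
      by (simp add: nn_integral_cmult)
    finally show "(\<integral>\<^sup>+w. ennreal (cmod (g (cis (2 * pi * x) *s w))) * indicator {0..1} x * ?B w \<partial>lborel)
        = indicator {0..1} x * (\<integral>\<^sup>+w. ennreal (cmod (g w)) * ?B w \<partial>lborel)" .
  qed
  also have "\<dots> = (\<integral>\<^sup>+w. ennreal (cmod (g w)) * ?B w \<partial>lborel)"
    by (simp add: nn_integral_multc)
  also have "\<dots> \<le> (\<integral>\<^sup>+w. ennreal (exp (pi * (norm z)\<^sup>2 / 2) * exp (pi / 2))
      * (ennreal (cmod (fock_weighted F (z + w))) * indicator (ball z 1) (z + w)) \<partial>lborel)"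
  proof (rule nn_integral_mono)
    fix w :: "complex ^ 'n"
    have "cmod (g w) \<le> exp (pi * (norm z)\<^sup>2 / 2) * exp (pi / 2) * cmod (fock_weighted F (z + w))" if "norm w < 1"
    proof -
      have "pi * (norm w)\<^sup>2 / 2 \<le> pi / 2"
        using that by (simp add: power_le_one)
      then show ?thesis
        unfolding norm_g by (simp add: mult_left_mono mult_ac)
    qed
    then show "ennreal (cmod (g w)) * ?B w \<le> ennreal (exp (pi * (norm z)\<^sup>2 / 2) * exp (pi / 2))
      * (ennreal (cmod (fock_weighted F (z + w))) * indicator (ball z 1) (z + w))"
      by (auto simp: dist_norm ennreal_mult[symmetric] split: split_indicator intro!: ennreal_leI)
  qed
  also have "\<dots> = ennreal (exp (pi * (norm z)\<^sup>2 / 2) * exp (pi / 2))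
      * (\<integral>\<^sup>+w. ennreal (cmod (fock_weighted F w)) * indicator (ball z 1) w \<partial>lborel)"
  proof -
    have [measurable]: "fock_weighted F \<in> borel_measurable borel"
      by (intro borel_measurable_continuous_onI fock_weighted_continuous assms)
    have [measurable]: "(indicator (ball z 1) :: _ \<Rightarrow> ennreal) \<in> borel_measurable borel"
      by (intro borel_measurable_indicator) simp
    show ?thesis
      using nn_integral_translate[of "\<lambda>w. ennreal (cmod (fock_weighted F w)) * indicator (ball z 1) w" z]
      by (simp add: nn_integral_cmult)
  qed
  finally have "ennreal (exp (pi * (norm z)\<^sup>2 / 2)) * (ennreal (cmod (fock_weighted F z)) * V)
      \<le> ennreal (exp (pi * (norm z)\<^sup>2 / 2)) * (ennreal (exp (pi / 2))
        * (\<integral>\<^sup>+w. ennreal (cmod (fock_weighted F w)) * indicator (ball z 1) w \<partial>lborel))"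
    by (simp add: norm_g ennreal_mult mult_ac)
  then have "ennreal (cmod (fock_weighted F z)) * V
      \<le> ennreal (exp (pi / 2)) * (\<integral>\<^sup>+w. ennreal (cmod (fock_weighted F w)) * indicator (ball z 1) w \<partial>lborel)"
    by (subst (asm) ennreal_mult_le_mult_iff) (auto simp: ennreal_zero_less_mult_iff)
  moreover have "V = emeasure lborel (ball z 1)"
    by (simp add: V_def emeasure_ball)
  ultimately show ?thesis
    by simp
qed

text \<open>
  The inclusion \<open>\<F>\<^sup>p \<subseteq> \<F>\<^sup>\<infinity>\<close>. By the mean value inequality it is enough to bound the integrals of the
  weighted function over unit balls uniformly in the centre. For finite exponent \<open>r \<ge> 1\<close> this
  follows from \<open>x \<le> 1 + x powr r\<close>; the constant obtained in this way depends on \<open>F\<close>, not linearly on its norm.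
\<close>

lemma fock_space_bounded:
  fixes F :: "complex ^ 'n \<Rightarrow> complex"
  assumes F: "F \<in> fock_space p" and p: "1 \<le> p"
  shows "\<exists>C. \<forall>w. cmod (fock_weighted F w) \<le> C"
proof -
  define V where "V = unit_ball_vol (real DIM(complex ^ 'n))"
  have V: "emeasure lborel (ball z 1 :: (complex ^ 'n) set) = ennreal V" "0 < V" for z
    by (simp_all add: V_def emeasure_ball)
  have F': "entire F" "fock_weighted F \<in> Lp_space p"
    using F by (auto simp: fock_space_def)
  have [measurable]: "fock_weighted F \<in> borel_measurable borel"
    by (intro borel_measurable_continuous_onI fock_weighted_continuous F')
  have [measurable]: "(indicator (ball z 1) :: complex ^ 'n \<Rightarrow> ennreal) \<in> borel_measurable borel" for z
    by (intro borel_measurable_indicator) simp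
  obtain D where D: "0 \<le> D"
    "\<And>z. (\<integral>\<^sup>+w. ennreal (cmod (fock_weighted F w)) * indicator (ball z 1) w \<partial>lborel) \<le> ennreal D"
  proof (cases "p = \<infinity>")
    case True
    define B where "B = enn2real (esssup lebesgue (\<lambda>x. ennreal (cmod (fock_weighted F x))))"
    have "esssup lebesgue (\<lambda>x. ennreal (cmod (fock_weighted F x))) = ennreal B"
      using F'(2) True by (simp add: B_def Lp_space_def)
    then have AE: "AE x in lebesgue. ennreal (cmod (fock_weighted F x)) \<le> ennreal B"
      using esssup_AE[of "\<lambda>x. ennreal (cmod (fock_weighted F x))" lebesgue] by simp
    show ?thesis
    proof
      show "0 \<le> B * V"
        using V(2) by (simp add: B_def)
      fix z :: "complex ^ 'n"
      have "(\<integral>\<^sup>+w. ennreal (cmod (fock_weighted F w)) * indicator (ball z 1) w \<partial>lborel)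
          = (\<integral>\<^sup>+w. ennreal (cmod (fock_weighted F w)) * indicator (ball z 1) w \<partial>lebesgue)"
        by (simp add: nn_integral_completion)
      also have "\<dots> \<le> (\<integral>\<^sup>+w. ennreal B * indicator (ball z 1) w \<partial>lebesgue)"
        by (rule nn_integral_mono_AE) (use AE in eventually_elim, simp add: mult_right_mono)
      also have "\<dots> = ennreal (B * V)"
        by (simp add: nn_integral_completion nn_integral_cmult V ennreal_mult B_def less_imp_le)
      finally show "(\<integral>\<^sup>+w. ennreal (cmod (fock_weighted F w)) * indicator (ball z 1) w \<partial>lborel) \<le> ennreal (B * V)" .
    qed
  next
    case False
    define r where "r = enn2real p"
    have r: "1 \<le> r"
      using p False unfolding r_def
      by (metis enn2real_mono enn2real_1 infinity_ennreal_def top.not_eq_extremum)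
    have int: "integrable lebesgue (\<lambda>x. cmod (fock_weighted F x) powr r)"
      using F'(2) False by (simp add: Lp_space_def r_def)
    define I where "I = (LINT x|lebesgue. cmod (fock_weighted F x) powr r)"
    have I: "(\<integral>\<^sup>+x. ennreal (cmod (fock_weighted F x) powr r) \<partial>lborel) = ennreal I" "0 \<le> I"
      using nn_integral_eq_integral[OF int] by (simp_all add: I_def nn_integral_completion)
    show ?thesis
    proof
      show "0 \<le> V + I"
        using V(2) I(2) by simp
      fix z :: "complex ^ 'n"
      have le: "x \<le> 1 + x powr r" if "0 \<le> x" for x :: real
      proof (cases "x \<le> 1")
        case False
        then have "x powr 1 \<le> x powr r"
          using r by (intro powr_mono) auto
        then show ?thesis
          using False by simp
      qed (simp add: add_increasing2)
      have "(\<integral>\<^sup>+w. ennreal (cmod (fock_weighted F w)) * indicator (ball z 1) w \<partial>lborel)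
          \<le> (\<integral>\<^sup>+w. indicator (ball z 1) w + ennreal (cmod (fock_weighted F w) powr r) \<partial>lborel)"
      proof (rule nn_integral_mono)
        fix w :: "complex ^ 'n"
        have "ennreal (cmod (fock_weighted F w)) \<le> ennreal (1 + cmod (fock_weighted F w) powr r)"
          by (intro ennreal_leI le) simp
        then show "ennreal (cmod (fock_weighted F w)) * indicator (ball z 1) w
            \<le> indicator (ball z 1) w + ennreal (cmod (fock_weighted F w) powr r)"
          by (auto split: split_indicator)
      qed
      also have "\<dots> = ennreal (V + I)"
        using V I by (simp add: nn_integral_add)
      finally show "(\<integral>\<^sup>+w. ennreal (cmod (fock_weighted F w)) * indicator (ball z 1) w \<partial>lborel) \<le> ennreal (V + I)" .
    qed
  qed
  show ?thesis
  proof (intro exI[of _ "exp (pi / 2) * D / V"] allI)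
    fix z :: "complex ^ 'n"
    have "ennreal (cmod (fock_weighted F z) * V)
        \<le> ennreal (exp (pi / 2)) * (\<integral>\<^sup>+w. ennreal (cmod (fock_weighted F w)) * indicator (ball z 1) w \<partial>lborel)"
      using fock_weighted_mean_value[OF F'(1), of z] V by (simp add: ennreal_mult less_imp_le)
    also have "\<dots> \<le> ennreal (exp (pi / 2)) * ennreal D"
      by (rule mult_left_mono) (use D in auto)
    finally have "cmod (fock_weighted F z) * V \<le> exp (pi / 2) * D"
      using D by (simp add: ennreal_mult[symmetric])
    then show "cmod (fock_weighted F z) \<le> exp (pi / 2) * D / V"
      using V(2) by (simp add: field_simps)
  qed
qed

lemma nn_integral_gaussian_finite:
  assumes "0 < a"
  shows "(\<integral>\<^sup>+x. ennreal (exp (- a * (norm (x :: 'a::euclidean_space))\<^sup>2)) \<partial>lborel) < \<infinity>"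
proof -
  \<comment> \<open>The standard deviation for which \<open>exp (- a x\<^sup>2)\<close> is proportional to the normal density.\<close>
  define \<sigma> where "\<sigma> = 1 / sqrt (2 * a)"
  have \<sigma>: "0 < \<sigma>" "2 * \<sigma>\<^sup>2 = 1 / a"
    using assms by (simp_all add: \<sigma>_def field_simps)
  have "exp (- a * x\<^sup>2) = sqrt (2 * pi * \<sigma>\<^sup>2) * normal_density 0 \<sigma> x" for x
    using \<sigma> assms by (simp add: normal_density_def)
  then have "integrable lborel (\<lambda>x::real. exp (- a * x\<^sup>2))"
    using integrable_normal_density[OF \<sigma>(1), of 0] by simp
  then have fin: "(\<integral>\<^sup>+x. ennreal (exp (- a * (x::real)\<^sup>2)) \<partial>lborel) < \<infinity>"
    by (simp add: nn_integral_eq_integral)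
  \<comment> \<open>The Gaussian is a product over the coordinates, so one dimension is enough.\<close>
  have "(norm x)\<^sup>2 = (\<Sum>b\<in>Basis. (x \<bullet> b)\<^sup>2)" for x :: 'a
    by (simp only: power2_norm_eq_inner euclidean_inner[of x x] flip: power2_eq_square)
  then have "ennreal (exp (- a * (norm x)\<^sup>2)) = (\<Prod>b\<in>Basis. ennreal (exp (- a * (x \<bullet> b)\<^sup>2)))" for x :: 'a
    by (simp add: sum_distrib_left exp_sum prod_ennreal flip: sum_negf)
  then have "(\<integral>\<^sup>+x. ennreal (exp (- a * (norm (x :: 'a))\<^sup>2)) \<partial>lborel)
      = (\<Prod>b\<in>(Basis :: 'a set). (\<integral>\<^sup>+x. ennreal (exp (- a * x\<^sup>2)) \<partial>lborel))"
    using nn_integral_lborel_prod[where f = "\<lambda>(b :: 'a) x. ennreal (exp (- a * x\<^sup>2))"] by simp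
  also have "\<dots> < \<infinity>"
    using fin by (simp add: power_less_top_ennreal)
  finally show ?thesis .
qed

text \<open>
  The point \<open>r w\<close> has the smaller weight exponent \<open>r\<^sup>2 |w|\<^sup>2\<close>, and what remains of the weight at \<open>w\<close> is a
  Gaussian. So for \<open>|r| < 1\<close> the dilates of a function in \<open>\<F>\<^sup>\<infinity>\<close> belong to \<open>\<F>\<^sup>1\<close>, and they are bounded in
  \<open>\<F>\<^sup>\<infinity>\<close> uniformly in \<open>r\<close>.
\<close>

lemma dilation_weighted_bound:
  assumes "\<And>w. cmod (fock_weighted F w) \<le> C"
  shows "cmod (fock_weighted (\<lambda>w. F (r *\<^sub>R w)) w) \<le> C * exp (- (pi * (1 - r\<^sup>2) / 2) * (norm w)\<^sup>2)"
proof -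
  have "cmod (fock_weighted (\<lambda>w. F (r *\<^sub>R w)) w)
      = cmod (fock_weighted F (r *\<^sub>R w)) * exp (- (pi * (1 - r\<^sup>2) / 2) * (norm w)\<^sup>2)"
    by (simp add: fock_weighted_def norm_mult power_mult_distrib mult.assoc field_simps flip: exp_add)
  then show ?thesis
    using assms by (simp add: mult_right_mono)
qed

lemma dilation_in_fock_space_1:
  fixes F :: "complex ^ 'n \<Rightarrow> complex"
  assumes "entire F" "\<And>w. cmod (fock_weighted F w) \<le> C" "\<bar>r\<bar> < 1"
  shows "(\<lambda>w. F (r *\<^sub>R w)) \<in> fock_space 1"
proof -
  let ?f = "fock_weighted (\<lambda>w. F (r *\<^sub>R w))"
  have ent: "entire (\<lambda>w. F (r *\<^sub>R w))"
    by (rule entire_dilation) fact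
  have [measurable]: "?f \<in> borel_measurable borel"
    by (intro borel_measurable_continuous_onI fock_weighted_continuous ent)
  have "0 \<le> C"
    using assms(2)[of 0] norm_ge_zero order_trans by blast
  have "0 < pi * (1 - r\<^sup>2) / 2"
    using assms(3) by (simp add: abs_square_less_1)
  from nn_integral_gaussian_finite[where 'a = "complex ^ 'n", OF this]
  have "(\<integral>\<^sup>+w. ennreal C * ennreal (exp (- (pi * (1 - r\<^sup>2) / 2) * (norm w)\<^sup>2)) \<partial>(lborel :: (complex ^ 'n) measure)) < \<infinity>"
    by (simp add: nn_integral_cmult ennreal_mult_less_top del: mult_minus_left)
  then have "(\<integral>\<^sup>+w. ennreal (cmod (?f w)) \<partial>lborel) < \<infinity>"
    by (rule le_less_trans[rotated])
       (intro nn_integral_mono, use dilation_weighted_bound[OF assms(2)] \<open>0 \<le> C\<close> in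
         \<open>simp add: ennreal_mult[symmetric] ennreal_leI del: mult_minus_left\<close>)
  then have "integrable lborel ?f"
    by (intro integrableI_bounded) auto
  then have "integrable lebesgue (\<lambda>w. cmod (?f w))"
    by (simp add: integrable_completion)
  then show ?thesis
    using ent by (simp add: fock_space_def Lp_space_def measurable_completion)
qed

section \<open>Schur's test\<close>

text \<open>
  Jensen's inequality for the measure with density \<open>k\<close>, of total mass at most \<open>M\<close>. The function
  \<open>x \<mapsto> x powr r\<close> is convex, so it lies above its tangent at \<open>t\<close>; solved for \<open>x\<close>, this is a form of Young's
  inequality. Integrating it against \<open>k\<close> with \<open>t = g / M\<close>, the term linear in \<open>t\<close> is absorbed into the
  left-hand side.
\<close>

lemma schur_test_pointwise:
  fixes u k :: "'a \<Rightarrow> real" and g M r :: real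
  assumes [measurable]: "u \<in> borel_measurable N" "k \<in> borel_measurable N"
    and u: "\<And>x. 0 \<le> u x" and k: "\<And>x. 0 \<le> k x"
    and M: "0 < M" "(\<integral>\<^sup>+x. ennreal (k x) \<partial>N) \<le> ennreal M"
    and r: "1 \<le> r"
    and g: "0 \<le> g" "ennreal g \<le> (\<integral>\<^sup>+x. ennreal (u x * k x) \<partial>N)"
  shows "ennreal (g powr r) \<le> ennreal (M powr (r - 1)) * (\<integral>\<^sup>+x. ennreal (u x powr r * k x) \<partial>N)"
proof (cases "g = 0 \<or> (\<integral>\<^sup>+x. ennreal (u x powr r * k x) \<partial>N) = \<infinity>")
  case True
  then show ?thesis
    using M(1) r by (auto simp: ennreal_mult_top)
next
  case False
  with g(1) have "0 < g" and fin: "(\<integral>\<^sup>+x. ennreal (u x powr r * k x) \<partial>N) \<noteq> \<infinity>"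
    by auto
  define a where "a = enn2real (\<integral>\<^sup>+x. ennreal (u x powr r * k x) \<partial>N)"
  have a: "0 \<le> a" "(\<integral>\<^sup>+x. ennreal (u x powr r * k x) \<partial>N) = ennreal a"
    using fin by (auto simp: a_def less_top)
  define t where "t = g / M"
  have t: "0 < t" "t * M = g"
    using \<open>0 < g\<close> M(1) by (auto simp: t_def)
  have young: "x \<le> t powr (1 - r) / r * x powr r + (1 - 1 / r) * t" if "0 \<le> x" for x
  proof (cases "x = 0")
    case True
    then show ?thesis
      using t r by simp
  next
    case False
    with that have "0 < x"
      by simp
    have "(x powr r * t powr (1 - r)) powr (1 / r) * t powr (1 - 1 / r)
        \<le> 1 / r * (x powr r * t powr (1 - r)) + (1 - 1 / r) * t"
      by (rule Youngs_inequality_0) (use r \<open>0 < x\<close> t in auto)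
    moreover have "(x powr r * t powr (1 - r)) powr (1 / r) * t powr (1 - 1 / r) = x"
    proof -
      have "(x powr r * t powr (1 - r)) powr (1 / r) * t powr (1 - 1 / r)
          = x * (t powr ((1 - r) / r) * t powr (1 - 1 / r))"
        using r \<open>0 < x\<close> t by (simp add: powr_mult powr_powr)
      also have "t powr ((1 - r) / r) * t powr (1 - 1 / r) = t powr ((1 - r) / r + (1 - 1 / r))"
        by (rule powr_add[symmetric])
      also have "(1 - r) / r + (1 - 1 / r) = 0"
        using r by (simp add: field_simps)
      finally show ?thesis
        using t by simp
    qed
    ultimately show ?thesis
      by (simp add: mult_ac)
  qed
  have "ennreal g \<le> (\<integral>\<^sup>+x. ennreal (u x * k x) \<partial>N)"
    by (rule g)
  also have "\<dots> \<le> (\<integral>\<^sup>+x. ennreal (t powr (1 - r) / r) * ennreal (u x powr r * k x)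
      + ennreal ((1 - 1 / r) * t) * ennreal (k x) \<partial>N)"
  proof (rule nn_integral_mono)
    fix x
    have "u x * k x \<le> (t powr (1 - r) / r * u x powr r + (1 - 1 / r) * t) * k x"
      by (intro mult_right_mono young u k)
    then have "ennreal (u x * k x)
        \<le> ennreal (t powr (1 - r) / r * (u x powr r * k x) + (1 - 1 / r) * t * k x)"
      by (intro ennreal_leI) (simp add: algebra_simps)
    moreover have "0 \<le> t powr (1 - r) / r" "0 \<le> (1 - 1 / r) * t" "0 \<le> u x powr r * k x"
      using r t k[of x] by simp_all
    ultimately show "ennreal (u x * k x) \<le> ennreal (t powr (1 - r) / r) * ennreal (u x powr r * k x)
        + ennreal ((1 - 1 / r) * t) * ennreal (k x)"
      using k[of x] by (simp only: ennreal_mult ennreal_plus mult_nonneg_nonneg)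
  qed
  also have "\<dots> = ennreal (t powr (1 - r) / r) * ennreal a + ennreal ((1 - 1 / r) * t) * (\<integral>\<^sup>+x. ennreal (k x) \<partial>N)"
    by (simp add: nn_integral_add nn_integral_cmult a)
  also have "\<dots> \<le> ennreal (t powr (1 - r) / r) * ennreal a + ennreal ((1 - 1 / r) * t) * ennreal M"
    by (intro add_left_mono mult_left_mono M) simp
  also have "\<dots> = ennreal (t powr (1 - r) / r * a + (1 - 1 / r) * t * M)"
  proof -
    have "0 \<le> t powr (1 - r) / r" "0 \<le> (1 - 1 / r) * t"
      using r t by simp_all
    then show ?thesis
      using a(1) M(1) by (simp only: ennreal_mult ennreal_plus mult_nonneg_nonneg less_imp_le)
  qed
  finally have "g \<le> t powr (1 - r) / r * a + (1 - 1 / r) * t * M"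
    using r t a M(1) by (subst (asm) ennreal_le_iff) auto
  then have "g / r \<le> t powr (1 - r) * a / r"
    using t r by (simp add: algebra_simps)
  then have "g \<le> t powr (1 - r) * a"
    using r by (simp add: divide_le_cancel)
  then have "g powr (r - 1) * g \<le> g powr (r - 1) * (t powr (1 - r) * a)"
    by (rule mult_left_mono) simp
  moreover have "g powr (r - 1) * t powr (1 - r) = M powr (r - 1)"
  proof -
    have "g powr (r - 1) = t powr (r - 1) * M powr (r - 1)"
      using t M(1) by (metis less_imp_le powr_mult)
    moreover have "t powr (r - 1) * t powr (1 - r) = 1"
      using t by (simp flip: powr_add)
    ultimately show ?thesis
      by simp
  qed
  moreover have "g powr (r - 1) * g = g powr r"
    using \<open>0 < g\<close> by (simp add: powr_diff)
  ultimately have "g powr r \<le> M powr (r - 1) * a"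
    by (simp add: mult.assoc[symmetric])
  then show ?thesis
    using a M by (simp add: ennreal_mult[symmetric] ennreal_leI)
qed

text \<open>
  Schur's test: the pointwise inequality is integrated over \<open>z\<close>, and exchanging the integrals leaves the
  column integrals of the kernel, which are again at most \<open>M\<close>.
\<close>

lemma schur_test:
  fixes u g :: "'a::euclidean_space \<Rightarrow> real" and K :: "'a \<Rightarrow> 'a \<Rightarrow> real"
  assumes [measurable]: "u \<in> borel_measurable borel"
    and K [measurable]: "case_prod K \<in> borel_measurable (borel \<Otimes>\<^sub>M borel)"
    and u: "\<And>x. 0 \<le> u x" and K0: "\<And>z w. 0 \<le> K z w"
    and M: "0 < M" "\<And>z. (\<integral>\<^sup>+w. ennreal (K z w) \<partial>lborel) \<le> ennreal M"
      "\<And>w. (\<integral>\<^sup>+z. ennreal (K z w) \<partial>lborel) \<le> ennreal M"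
    and r: "1 \<le> r"
    and g: "\<And>z. 0 \<le> g z" "\<And>z. ennreal (g z) \<le> (\<integral>\<^sup>+w. ennreal (u w * K z w) \<partial>lborel)"
  shows "(\<integral>\<^sup>+z. ennreal (g z powr r) \<partial>lborel) \<le> ennreal (M powr r) * (\<integral>\<^sup>+w. ennreal (u w powr r) \<partial>lborel)"
proof -
  have "(\<integral>\<^sup>+z. ennreal (g z powr r) \<partial>lborel)
      \<le> (\<integral>\<^sup>+z. ennreal (M powr (r - 1)) * (\<integral>\<^sup>+w. ennreal (u w powr r * K z w) \<partial>lborel) \<partial>lborel)"
    by (intro nn_integral_mono schur_test_pointwise) (use assms in auto)
  also have "\<dots> = ennreal (M powr (r - 1)) * (\<integral>\<^sup>+w. (\<integral>\<^sup>+z. ennreal (u w powr r * K z w) \<partial>lborel) \<partial>lborel)"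
    by (subst lborel_pair.Fubini') (simp_all add: nn_integral_cmult)
  also have "\<dots> = ennreal (M powr (r - 1)) * (\<integral>\<^sup>+w. ennreal (u w powr r) * (\<integral>\<^sup>+z. ennreal (K z w) \<partial>lborel) \<partial>lborel)"
    by (simp add: ennreal_mult K0 nn_integral_cmult)
  also have "\<dots> \<le> ennreal (M powr (r - 1)) * (\<integral>\<^sup>+w. ennreal (u w powr r) * ennreal M \<partial>lborel)"
    by (intro mult_left_mono nn_integral_mono M) simp_all
  also have "\<dots> = ennreal (M powr (r - 1) * M) * (\<integral>\<^sup>+w. ennreal (u w powr r) \<partial>lborel)"
    using M(1) by (simp add: nn_integral_multc ennreal_mult mult.assoc) (simp add: mult.commute)
  also have "M powr (r - 1) * M = M powr r"
    using M(1) by (simp add: powr_diff)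
  finally show ?thesis .
qed

text \<open>
  This passes from the estimate of extended nonnegative integrals given by Schur's test to membership
  in the space and the inequality of norms.
\<close>

lemma Lp_space_finite_dominated:
  fixes f g :: "complex ^ 'n \<Rightarrow> complex"
  assumes p: "1 \<le> p" "p \<noteq> \<infinity>" and f: "f \<in> Lp_space p" and [measurable]: "g \<in> borel_measurable borel"
    and M: "0 < M"
    and le: "(\<integral>\<^sup>+z. ennreal (cmod (g z) powr enn2real p) \<partial>lborel)
      \<le> ennreal (M powr enn2real p) * (\<integral>\<^sup>+z. ennreal (cmod (f z) powr enn2real p) \<partial>lborel)"
  shows "g \<in> Lp_space p \<and> Lp_norm p g \<le> M * Lp_norm p f"
proof -
  define r where "r = enn2real p"
  have r: "0 < r"
    using p unfolding r_def by (auto simp: enn2real_positive_iff less_top intro: less_le_trans[OF zero_less_one])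
  have int: "integrable lebesgue (\<lambda>x. cmod (f x) powr r)"
    using f p(2) by (simp add: Lp_space_def r_def)
  define I where "I = (LINT x|lebesgue. cmod (f x) powr r)"
  have I: "0 \<le> I" "(\<integral>\<^sup>+z. ennreal (cmod (f z) powr r) \<partial>lborel) = ennreal I"
    using nn_integral_eq_integral[OF int] by (simp_all add: I_def nn_integral_completion)
  have g_le: "(\<integral>\<^sup>+z. ennreal (cmod (g z) powr r) \<partial>lborel) \<le> ennreal (M powr r * I)"
    using le I by (simp add: r_def ennreal_mult)
  have [measurable]: "g \<in> borel_measurable lebesgue"
    by (rule measurable_completion) simp
  have int_g: "integrable lebesgue (\<lambda>x. cmod (g x) powr r)"
  proof (rule integrableI_bounded)
    show "(\<integral>\<^sup>+z. ennreal (norm (cmod (g z) powr r)) \<partial>lebesgue) < \<infinity>"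
      using le_less_trans[OF g_le] by (simp add: nn_integral_completion)
  qed simp
  have "(LINT x|lebesgue. cmod (g x) powr r) \<le> M powr r * I"
    using g_le I(1) nn_integral_eq_integral[OF int_g] by (simp add: nn_integral_completion)
  then have "(LINT x|lebesgue. cmod (g x) powr r) powr (1 / r) \<le> (M powr r * I) powr (1 / r)"
    using r by (intro powr_mono2) auto
  also have "\<dots> = M * I powr (1 / r)"
    using r M I(1) by (simp add: powr_mult powr_powr)
  finally have "Lp_norm p g \<le> M * Lp_norm p f"
    using p(2) by (simp add: Lp_norm_def r_def I_def)
  moreover have "g \<in> Lp_space p"
    using p(2) int_g by (simp add: Lp_space_def r_def)
  ultimately show ?thesis
    by simp
qed

text \<open>
  The endpoint of Schur's test: the supremum is taken out of the integral and only the row integrals of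
  the kernel matter.
\<close>

lemma Lp_space_infinity_dominated:
  fixes f g :: "complex ^ 'n \<Rightarrow> complex" and K :: "complex ^ 'n \<Rightarrow> complex ^ 'n \<Rightarrow> real"
  assumes f: "f \<in> Lp_space \<infinity>" and [measurable]: "g \<in> borel_measurable borel"
    and M: "0 < M" "\<And>z. (\<integral>\<^sup>+w. ennreal (K z w) \<partial>lborel) \<le> ennreal M"
    and [measurable]: "case_prod K \<in> borel_measurable (borel \<Otimes>\<^sub>M borel)" and K: "\<And>z w. 0 \<le> K z w"
    and le: "\<And>z. ennreal (cmod (g z)) \<le> (\<integral>\<^sup>+w. ennreal (cmod (f w) * K z w) \<partial>lborel)"
  shows "g \<in> Lp_space \<infinity> \<and> Lp_norm \<infinity> g \<le> M * Lp_norm \<infinity> f"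
proof -
  define B where "B = Lp_norm \<infinity> f"
  have "0 \<le> B" and B: "esssup lebesgue (\<lambda>x. ennreal (cmod (f x))) = ennreal B"
    using f by (simp_all add: B_def Lp_norm_def Lp_space_def)
  then have AE: "AE x in lebesgue. cmod (f x) \<le> B"
    using esssup_AE[of "\<lambda>x. ennreal (cmod (f x))" lebesgue] by simp
  have bound: "ennreal (cmod (g z)) \<le> ennreal (M * B)" for z
  proof -
    have "ennreal (cmod (g z)) \<le> (\<integral>\<^sup>+w. ennreal (cmod (f w) * K z w) \<partial>lebesgue)"
      using le by (simp add: nn_integral_completion)
    also have "\<dots> \<le> (\<integral>\<^sup>+w. ennreal B * ennreal (K z w) \<partial>lebesgue)"
      by (rule nn_integral_mono_AE)
         (use AE in eventually_elim, use \<open>0 \<le> B\<close> K in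
           \<open>simp add: ennreal_mult[symmetric] ennreal_leI mult_right_mono\<close>)
    also have "\<dots> = ennreal B * (\<integral>\<^sup>+w. ennreal (K z w) \<partial>lborel)"
      by (simp add: nn_integral_completion nn_integral_cmult)
    also have "\<dots> \<le> ennreal B * ennreal M"
      by (intro mult_left_mono M) simp
    finally show ?thesis
      using \<open>0 \<le> B\<close> M(1) by (simp add: ennreal_mult mult.commute)
  qed
  have [measurable]: "g \<in> borel_measurable lebesgue"
    by (rule measurable_completion) simp
  have "esssup lebesgue (\<lambda>x. ennreal (cmod (g x))) \<le> ennreal (M * B)"
    by (rule esssup_I) (simp_all add: bound)
  moreover from this have "esssup lebesgue (\<lambda>x. ennreal (cmod (g x))) < \<infinity>"
    by (rule le_less_trans) simp
  ultimately show ?thesis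
    using \<open>0 \<le> B\<close> M(1) enn2real_mono[of "esssup lebesgue (\<lambda>x. ennreal (cmod (g x)))" "ennreal (M * B)"]
    by (simp add: Lp_space_def Lp_norm_def B_def)
qed

section \<open>The weighted kernel of the operator\<close>

text \<open>
  The modulus of the integral kernel of the operator after both sides are multiplied by their Gaussian
  weights; see \<open>norm_fock_integrand\<close>. In contrast to the majorant \<open>H\<close>, it is continuous, hence jointly
  Borel measurable.
\<close>

definition fock_kernel :: "(complex ^ 'n \<Rightarrow> complex) \<Rightarrow> complex ^ 'n \<Rightarrow> complex ^ 'n \<Rightarrow> real" where
  "fock_kernel \<phi> z w = cmod (\<phi> (vcnj w - z)) * exp (- pi * (norm (w - z))\<^sup>2 / 2)"

lemma fock_kernel_nonneg: "0 \<le> fock_kernel \<phi> z w"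
  by (simp add: fock_kernel_def)

lemma norm_fock_integrand:
  "cmod (fock_integrand \<phi> F z w)
    = exp (pi * (norm z)\<^sup>2 / 2) * (cmod (fock_weighted F w) * fock_kernel \<phi> z w)"
proof -
  have e: "exp (pi * Re (z \<otimes>\<^sub>c vcnj w)) * exp (- pi * (norm w)\<^sup>2)
      = exp (pi * (norm z)\<^sup>2 / 2) * (exp (- pi * (norm w)\<^sup>2 / 2) * exp (- pi * (norm (w - z))\<^sup>2 / 2))"
    unfolding norm_diff_sq_cprod exp_add[symmetric] by (simp add: field_simps)
  have "cmod (fock_integrand \<phi> F z w)
      = cmod (F w) * cmod (\<phi> (vcnj w - z)) * (exp (pi * Re (z \<otimes>\<^sub>c vcnj w)) * exp (- pi * (norm w)\<^sup>2))"
    by (simp add: fock_integrand_def norm_mult)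
  also have "\<dots> = exp (pi * (norm z)\<^sup>2 / 2) * (cmod (fock_weighted F w) * fock_kernel \<phi> z w)"
    unfolding e by (simp add: fock_weighted_def fock_kernel_def norm_mult)
  finally show ?thesis .
qed

text \<open>
  The exponent in the hypothesis on \<open>\<phi>\<close> has real part \<open>\<pi> |w - z|\<^sup>2 / 2\<close>, which is exactly what the Gaussian
  in \<open>fock_kernel\<close> cancels.
\<close>

lemma fock_kernel_le:
  assumes "cmod (\<phi> (vcnj w - z)) \<le>
    cmod (exp (of_real (pi * ((norm w)\<^sup>2 + (norm z)\<^sup>2) / 2) - of_real pi * (z \<otimes>\<^sub>c vcnj w))) * h"
  shows "fock_kernel \<phi> z w \<le> h"
proof -
  have "cmod (exp (of_real (pi * ((norm w)\<^sup>2 + (norm z)\<^sup>2) / 2) - of_real pi * (z \<otimes>\<^sub>c vcnj w)))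
      = exp (pi * ((norm w)\<^sup>2 + (norm z)\<^sup>2) / 2 - pi * Re (z \<otimes>\<^sub>c vcnj w))"
    by simp
  also have "pi * ((norm w)\<^sup>2 + (norm z)\<^sup>2) / 2 - pi * Re (z \<otimes>\<^sub>c vcnj w) = pi * (norm (w - z))\<^sup>2 / 2"
    unfolding norm_diff_sq_cprod by (simp add: field_simps)
  finally have "cmod (exp (of_real (pi * ((norm w)\<^sup>2 + (norm z)\<^sup>2) / 2) - of_real pi * (z \<otimes>\<^sub>c vcnj w)))
      = exp (pi * (norm (w - z))\<^sup>2 / 2)" .
  from assms[unfolded this] have "fock_kernel \<phi> z w
      \<le> (exp (pi * (norm (w - z))\<^sup>2 / 2) * h) * exp (- pi * (norm (w - z))\<^sup>2 / 2)"
    unfolding fock_kernel_def by (rule mult_right_mono) simp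
  then show ?thesis
    by (simp add: exp_minus field_simps)
qed

lemma fock_kernel_measurable:
  assumes "entire \<phi>"
  shows "case_prod (fock_kernel \<phi>) \<in> borel_measurable (borel \<Otimes>\<^sub>M borel)"
  unfolding fock_kernel_def case_prod_beta borel_prod
  by (intro borel_measurable_continuous_onI continuous_intros
      continuous_on_compose2[OF entire_continuous[OF assms]]) auto

lemma fock_integrand_measurable:
  assumes "entire \<phi>" "entire F"
  shows "fock_integrand \<phi> F z \<in> borel_measurable borel"
  unfolding fock_integrand_def
  by (intro borel_measurable_continuous_onI continuous_intros entire_continuous[OF assms(2)]
      continuous_on_compose2[OF entire_continuous[OF assms(1)]]) auto

text \<open>
  For fixed \<open>z\<close> or fixed \<open>w\<close>, a translation, or a reflection and a translation, makes the majorant the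
  same function \<open>H\<close> of the integration variable. Only the kernel is translated, and the comparison
  with \<open>H\<close> comes last: \<open>H\<close> is merely Lebesgue measurable.
\<close>

lemma fock_kernel_integrals:
  fixes \<phi> :: "complex ^ 'n \<Rightarrow> complex"
  assumes \<phi>: "entire \<phi>" and H: "integrable lebesgue H"
    and le: "\<And>z w. fock_kernel \<phi> z w \<le> H (w - z)"
  shows "\<exists>M>0. (\<forall>z. (\<integral>\<^sup>+w. ennreal (fock_kernel \<phi> z w) \<partial>lborel) \<le> ennreal M)
    \<and> (\<forall>w. (\<integral>\<^sup>+z. ennreal (fock_kernel \<phi> z w) \<partial>lborel) \<le> ennreal M)"
proof -
  note [measurable] = fock_kernel_measurable[OF \<phi>]
  define I where "I = (\<integral>\<^sup>+x. ennreal (norm (H x)) \<partial>lebesgue)"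
  have I: "I < \<infinity>"
    using H by (simp add: integrable_iff_bounded I_def)
  have I': "I \<le> ennreal (enn2real I + 1)"
    using I by (simp add: ennreal_plus less_top)
  show ?thesis
  proof (intro exI[of _ "enn2real I + 1"] conjI allI)
    \<comment> \<open>The added 1 makes the bound positive even if \<open>H\<close> vanishes almost everywhere.\<close>
    show "0 < enn2real I + 1"
      by (simp add: add_nonneg_pos)
    show "(\<integral>\<^sup>+w. ennreal (fock_kernel \<phi> z w) \<partial>lborel) \<le> ennreal (enn2real I + 1)" for z
    proof -
      have "(\<integral>\<^sup>+w. ennreal (fock_kernel \<phi> z w) \<partial>lborel) = (\<integral>\<^sup>+u. ennreal (fock_kernel \<phi> z (z + u)) \<partial>lebesgue)"
        using nn_integral_translate[of "\<lambda>w. ennreal (fock_kernel \<phi> z w)" z]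
        by (simp add: nn_integral_completion)
      also have "\<dots> \<le> I"
        unfolding I_def
        by (intro nn_integral_mono ennreal_leI order_trans[OF le]) simp
      finally show ?thesis
        using I' by (rule order_trans)
    qed
    show "(\<integral>\<^sup>+z. ennreal (fock_kernel \<phi> z w) \<partial>lborel) \<le> ennreal (enn2real I + 1)" for w
    proof -
      have "(\<integral>\<^sup>+z. ennreal (fock_kernel \<phi> z w) \<partial>lborel) = (\<integral>\<^sup>+u. ennreal (fock_kernel \<phi> (w + u) w) \<partial>lborel)"
        using nn_integral_translate[of "\<lambda>z. ennreal (fock_kernel \<phi> z w)" w] by simp
      also have "\<dots> = (\<integral>\<^sup>+u. ennreal (fock_kernel \<phi> (w - u) w) \<partial>lebesgue)"
      proof -
        have "linear (\<lambda>u :: complex ^ 'n. - u)"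
          by (rule linearI) simp_all
        from nn_integral_linear_isometry[OF this, of "\<lambda>u. ennreal (fock_kernel \<phi> (w + u) w)"]
        show ?thesis
          by (simp add: nn_integral_completion)
      qed
      also have "\<dots> \<le> I"
        unfolding I_def
        by (intro nn_integral_mono ennreal_leI order_trans[OF le]) simp
      finally show ?thesis
        using I' by (rule order_trans)
    qed
  qed
qed

text \<open>
  The kernel concentrates near the diagonal uniformly in \<open>z\<close>, because its tails are dominated by the
  tails of the one integrable function \<open>H\<close>.
\<close>

lemma fock_kernel_tail:
  fixes \<phi> :: "complex ^ 'n \<Rightarrow> complex"
  assumes \<phi>: "entire \<phi>" and H: "integrable lebesgue H"
    and le: "\<And>z w. fock_kernel \<phi> z w \<le> H (w - z)" and e: "0 < e"
  shows "\<exists>N::nat. \<forall>z. (\<integral>\<^sup>+w. ennreal (fock_kernel \<phi> z w) * indicator {w. real N \<le> norm (w - z)} w \<partial>lborel) \<le> ennreal e"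
proof -
  note [measurable] = fock_kernel_measurable[OF \<phi>]
  have [measurable]: "H \<in> borel_measurable lebesgue"
    using H by simp
  have H_nonneg: "0 \<le> H u" for u
    using le[of 0 u] fock_kernel_nonneg[of \<phi> 0 u] by simp
  have fin: "(\<integral>\<^sup>+u. ennreal (H u) \<partial>lebesgue) < \<infinity>"
    using H H_nonneg by (simp add: integrable_iff_bounded)
  define A where "A = (\<lambda>n::nat. {u :: complex ^ 'n. real n \<le> norm u})"
  have closed: "closed (A n)" for n
    unfolding A_def by (intro closed_Collect_le continuous_intros)
  then have [measurable]: "A n \<in> sets borel" for n
    by auto
  then have [measurable]: "A n \<in> sets lebesgue" for n
    by auto
  have "(\<lambda>n. \<integral>\<^sup>+u. ennreal (H u) * indicator (A n) u \<partial>lebesgue) \<longlonglongrightarrow> (\<integral>\<^sup>+u. 0 \<partial>(lebesgue :: (complex ^ 'n) measure))"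
  proof (rule nn_integral_dominated_convergence[OF _ _ _ _ fin])
    show "AE u in lebesgue. (\<lambda>n. ennreal (H u) * indicator (A n) u) \<longlonglongrightarrow> 0"
    proof (rule AE_I2, rule tendsto_eventually)
      fix u :: "complex ^ 'n"
      obtain m :: nat where "norm u < real m"
        using reals_Archimedean2 by blast
      then show "\<forall>\<^sub>F n in sequentially. ennreal (H u) * indicator (A n) u = 0"
        unfolding eventually_sequentially
        by (intro exI[of _ m]) (auto simp: A_def indicator_def)
    qed
    show "AE u in lebesgue. ennreal (H u) * indicator (A n) u \<le> ennreal (H u)" for n
      by (rule AE_I2) (simp split: split_indicator)
  qed auto
  then have "\<forall>\<^sub>F n in sequentially. (\<integral>\<^sup>+u. ennreal (H u) * indicator (A n) u \<partial>lebesgue) < ennreal e"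
    using e by (intro order_tendstoD(2)) auto
  then obtain N where N: "(\<integral>\<^sup>+u. ennreal (H u) * indicator (A N) u \<partial>lebesgue) < ennreal e"
    by (meson eventually_happens trivial_limit_sequentially)
  show ?thesis
  proof (intro exI[of _ N] allI)
    fix z :: "complex ^ 'n"
    have [measurable]: "(\<lambda>w. indicator (A N) (w - z) :: ennreal) \<in> borel_measurable borel"
      by measurable
    have "(\<integral>\<^sup>+w. ennreal (fock_kernel \<phi> z w) * indicator {w. real N \<le> norm (w - z)} w \<partial>lborel)
        = (\<integral>\<^sup>+w. ennreal (fock_kernel \<phi> z w) * indicator (A N) (w - z) \<partial>lborel)"
      by (rule nn_integral_cong) (simp add: A_def indicator_def)
    also have "\<dots> = (\<integral>\<^sup>+u. ennreal (fock_kernel \<phi> z (z + u)) * indicator (A N) u \<partial>lebesgue)"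
      using nn_integral_translate[of "\<lambda>w. ennreal (fock_kernel \<phi> z w) * indicator (A N) (w - z)" z]
      by (simp add: nn_integral_completion)
    also have "\<dots> \<le> (\<integral>\<^sup>+u. ennreal (H u) * indicator (A N) u \<partial>lebesgue)"
      by (intro nn_integral_mono mult_right_mono ennreal_leI order_trans[OF le]) simp_all
    finally show "(\<integral>\<^sup>+w. ennreal (fock_kernel \<phi> z w) * indicator {w. real N \<le> norm (w - z)} w \<partial>lborel) \<le> ennreal e"
      using N by simp
  qed
qed

text \<open>
  The weighted function is bounded, and the kernel is integrable in \<open>w\<close>. Thus convergence holds for every
  \<open>z\<close>, while \<open>L\<^sup>p\<close> bounds alone would only give it for almost every \<open>z\<close>.
\<close>

lemma fock_integrand_integrable:
  assumes "entire \<phi>" "entire F" and C: "\<And>w. cmod (fock_weighted F w) \<le> C"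
    and M: "\<And>z. (\<integral>\<^sup>+w. ennreal (fock_kernel \<phi> z w) \<partial>lborel) \<le> ennreal M"
  shows "integrable lborel (fock_integrand \<phi> F z)"
proof (rule integrableI_bounded)
  note [measurable] = fock_kernel_measurable[OF assms(1)]
  show "fock_integrand \<phi> F z \<in> borel_measurable lborel"
    using fock_integrand_measurable assms by simp
  have "0 \<le> C"
    using C[of 0] norm_ge_zero order_trans by blast
  have "(\<integral>\<^sup>+w. ennreal (cmod (fock_integrand \<phi> F z w)) \<partial>lborel)
      \<le> (\<integral>\<^sup>+w. ennreal (exp (pi * (norm z)\<^sup>2 / 2) * C) * ennreal (fock_kernel \<phi> z w) \<partial>lborel)"
    using \<open>0 \<le> C\<close> fock_kernel_nonneg[of \<phi>]
    by (intro nn_integral_mono)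
       (auto simp: norm_fock_integrand ennreal_mult[symmetric] mult.assoc
         intro!: ennreal_leI mult_left_mono mult_right_mono C)
  also have "\<dots> \<le> ennreal (exp (pi * (norm z)\<^sup>2 / 2) * C) * ennreal M"
    by (simp add: nn_integral_cmult mult_left_mono M)
  also have "\<dots> < \<infinity>"
    by (simp add: ennreal_mult_less_top)
  finally show "(\<integral>\<^sup>+w. ennreal (cmod (fock_integrand \<phi> F z w)) \<partial>lborel) < \<infinity>" .
qed

lemma fock_op_lborel:
  assumes "entire \<phi>" "entire F"
  shows "fock_op \<phi> F z = (LINT w|lborel. fock_integrand \<phi> F z w)"
  using fock_integrand_measurable[OF assms] by (simp add: fock_op_def integral_completion)

lemma fock_op_pointwise_bound:
  assumes "entire \<phi>" "entire F" and int: "integrable lborel (fock_integrand \<phi> F z)"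
  shows "ennreal (cmod (fock_weighted (fock_op \<phi> F) z))
    \<le> (\<integral>\<^sup>+w. ennreal (cmod (fock_weighted F w) * fock_kernel \<phi> z w) \<partial>lborel)"
proof -
  note [measurable] = fock_kernel_measurable[OF assms(1)]
  have [measurable]: "fock_weighted F \<in> borel_measurable borel"
    by (intro borel_measurable_continuous_onI fock_weighted_continuous assms)
  have "ennreal (cmod (fock_op \<phi> F z)) \<le> (\<integral>\<^sup>+w. ennreal (cmod (fock_integrand \<phi> F z w)) \<partial>lborel)"
    unfolding fock_op_lborel[OF assms(1,2)] by (rule integral_norm_bound_ennreal[OF int])
  also have "\<dots> = ennreal (exp (pi * (norm z)\<^sup>2 / 2))
      * (\<integral>\<^sup>+w. ennreal (cmod (fock_weighted F w) * fock_kernel \<phi> z w) \<partial>lborel)"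
    by (simp add: norm_fock_integrand ennreal_mult' nn_integral_cmult del: ennreal_mult'')
  finally have "ennreal (exp (- pi * (norm z)\<^sup>2 / 2)) * ennreal (cmod (fock_op \<phi> F z))
      \<le> ennreal (exp (- pi * (norm z)\<^sup>2 / 2)) * (ennreal (exp (pi * (norm z)\<^sup>2 / 2))
      * (\<integral>\<^sup>+w. ennreal (cmod (fock_weighted F w) * fock_kernel \<phi> z w) \<partial>lborel))"
    by (rule mult_left_mono) simp
  moreover have "ennreal (exp (- pi * (norm z)\<^sup>2 / 2)) * ennreal (exp (pi * (norm z)\<^sup>2 / 2)) = 1"
    by (simp flip: ennreal_mult exp_add)
  moreover have "ennreal (exp (- pi * (norm z)\<^sup>2 / 2)) * ennreal (cmod (fock_op \<phi> F z))
      = ennreal (cmod (fock_weighted (fock_op \<phi> F) z))"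
    by (simp add: fock_weighted_def norm_mult ennreal_mult mult.commute)
  ultimately show ?thesis
    by (simp only: mult.assoc[symmetric] mult_1_left)
qed

section \<open>Holomorphy of the image\<close>

text \<open>
  The integrable majorant does not allow differentiation under the integral sign, since it is not a
  majorant uniformly for \<open>z\<close> in a neighbourhood. Instead \<open>F\<close> is approximated by its dilates \<open>F (r w)\<close> with
  \<open>r < 1\<close>. They belong to \<open>\<F>\<^sup>1\<close>, so the operator maps them to entire functions by hypothesis, and the images
  converge locally uniformly: near \<open>z\<close> the dilates converge to \<open>F\<close> uniformly, and far from \<open>z\<close> both are
  bounded by the same constant while the kernel has little mass there. The limit is entire by
  \<open>entire_locally_uniform_limit\<close>.
\<close>

lemma fock_op_entire:
  fixes \<phi> :: "complex ^ 'n \<Rightarrow> complex"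
  assumes \<phi>: "entire \<phi>" and H: "integrable lebesgue H"
    and le: "\<And>z w. fock_kernel \<phi> z w \<le> H (w - z)"
    and op: "\<And>F. F \<in> fock_space 1 \<Longrightarrow> entire (fock_op \<phi> F)"
    and F: "entire F" and C: "\<And>w. cmod (fock_weighted F w) \<le> C"
  shows "entire (fock_op \<phi> F)"
proof -
  note [measurable] = fock_kernel_measurable[OF \<phi>]
  from fock_kernel_integrals[OF \<phi> H le]
  obtain M where M: "0 < M" and M_all: "\<forall>z. (\<integral>\<^sup>+w. ennreal (fock_kernel \<phi> z w) \<partial>lborel) \<le> ennreal M"
    by auto
  note M = M M_all[rule_format]
  have "0 \<le> C"
    using C[of 0] norm_ge_zero order_trans by blast
  define r where "r = (\<lambda>n::nat. 1 - 1 / (real n + 1))"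
  have r: "0 \<le> r n" "r n < 1" for n
    by (simp_all add: r_def field_simps)
  define D where "D = (\<lambda>n w. F (r n *\<^sub>R w))"
  have D: "D n \<in> fock_space 1" "entire (D n)" for n
    unfolding D_def
    by (rule dilation_in_fock_space_1[OF F C], use r[of n] in simp, rule entire_dilation[OF F])
  have DC: "cmod (fock_weighted (D n) w) \<le> C" for n w
  proof -
    have "exp (- (pi * (1 - (r n)\<^sup>2) / 2) * (norm w)\<^sup>2) \<le> 1"
      using r[of n] by (simp add: power_le_one)
    then have "C * exp (- (pi * (1 - (r n)\<^sup>2) / 2) * (norm w)\<^sup>2) \<le> C"
      using \<open>0 \<le> C\<close> by (rule mult_left_le)
    with dilation_weighted_bound[OF C, where r = "r n"] show ?thesis
      unfolding D_def by (rule order_trans)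
  qed
  have int: "integrable lborel (fock_integrand \<phi> (D n) z)" "integrable lborel (fock_integrand \<phi> F z)" for n z
    by (rule fock_integrand_integrable[OF \<phi> D(2) DC M(2)], rule fock_integrand_integrable[OF \<phi> F C M(2)])
  show ?thesis
  proof (rule entire_locally_uniform_limit)
    show "entire (fock_op \<phi> (D n))" for n
      by (rule op) (rule D)
    fix R e :: real
    assume "0 < e"
    define E where "E = exp (pi * R\<^sup>2 / 2)"
    \<comment> \<open>Tolerances for the part of the integral near the diagonal (uniform error \<open>\<delta>\<close>, kernel mass \<open>M\<close>) and
      for the tail (error \<open>2 * C\<close>, kernel mass \<open>\<eta>\<close>); each part contributes at most \<open>e / 2\<close>.\<close>
    define \<delta> where "\<delta> = e / (2 * E * M)"
    define \<eta> where "\<eta> = e / (2 * E * (2 * C + 1))"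
    have pos: "0 < E" "0 < \<delta>" "0 < \<eta>"
      using \<open>0 < e\<close> M(1) \<open>0 \<le> C\<close> by (simp_all add: E_def \<delta>_def \<eta>_def)
    have small: "E * (\<delta> * M + 2 * C * \<eta>) \<le> e"
    proof -
      have "E * (\<delta> * M) = e / 2"
        using pos(1) M(1) by (simp add: \<delta>_def)
      moreover have "E * (2 * C * \<eta>) = e / 2 * (2 * C / (2 * C + 1))"
        using pos(1) by (simp add: \<eta>_def)
      moreover have "2 * C / (2 * C + 1) \<le> 1"
        using \<open>0 \<le> C\<close> by simp
      then have "e / 2 * (2 * C / (2 * C + 1)) \<le> e / 2"
        using \<open>0 < e\<close> by (intro mult_left_le) auto
      ultimately show ?thesis
        by (simp only: distrib_left)
    qed
    from fock_kernel_tail[OF \<phi> H le pos(3)] obtain N :: nat where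
      "\<forall>z. (\<integral>\<^sup>+w. ennreal (fock_kernel \<phi> z w) * indicator {w. real N \<le> norm (w - z)} w \<partial>lborel) \<le> ennreal \<eta>" ..
    note N = this[rule_format]
    \<comment> \<open>If \<open>|z| \<le> R\<close> and \<open>|w - z| < N\<close>, then \<open>w\<close> lies in the compact ball of radius \<open>L\<close>.\<close>
    define L where "L = real N + \<bar>R\<bar>"
    have "uniformly_continuous_on (cball 0 L) F"
      by (intro compact_uniformly_continuous continuous_on_subset[OF entire_continuous[OF F]]) auto
    from this[unfolded uniformly_continuous_on_def, rule_format, OF pos(2)]
    obtain d where d: "0 < d"
      "\<forall>x\<in>cball 0 L. \<forall>x'\<in>cball 0 L. dist x' x < d \<longrightarrow> dist (F x') (F x) < \<delta>"
      by blast
    obtain n0 :: nat where n0: "L / d < real n0"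
      using reals_Archimedean2 by blast
    have near: "cmod (D n w - F w) \<le> \<delta>" if "n0 \<le> n" "w \<in> cball 0 L" for n w
    proof -
      have "dist (r n *\<^sub>R w) w = norm w / (real n + 1)"
      proof -
        have "r n *\<^sub>R w - w = (- (1 / (real n + 1))) *\<^sub>R w"
          by (simp add: r_def algebra_simps)
        then show ?thesis
          by (simp only: dist_norm norm_scaleR) simp
      qed
      also have "\<dots> < d"
      proof -
        have "norm w \<le> L"
          using that by simp
        also have "L < d * real n0"
          using n0 d(1) by (simp add: field_simps)
        also have "\<dots> \<le> d * (real n + 1)"
          using that d(1) by simp
        finally show ?thesis
          by (simp add: field_simps)
      qed
      finally have "dist (r n *\<^sub>R w) w < d" .
      moreover have "r n *\<^sub>R w \<in> cball 0 L"
        using that(2) r[of n] mult_left_le_one_le[of "norm w" "r n"] by simp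
      ultimately show ?thesis
        using d(2)[rule_format, OF that(2), of "r n *\<^sub>R w"] by (simp add: D_def dist_norm)
    qed
    have "cmod (fock_op \<phi> (D n) z - fock_op \<phi> F z) \<le> e" if n: "n0 \<le> n" and z: "z \<in> cball 0 R" for n z
    proof -
      let ?W = "fock_weighted (\<lambda>w. D n w - F w)"
      let ?I = "indicator {w. real N \<le> norm (w - z)} :: complex ^ 'n \<Rightarrow> real"
      have [measurable]: "?I \<in> borel_measurable borel"
        by (intro borel_measurable_indicator borel_closed closed_Collect_le continuous_intros)
      have [measurable]: "(indicator {w. real N \<le> norm (w - z)} :: complex ^ 'n \<Rightarrow> ennreal) \<in> borel_measurable borel"
        by (intro borel_measurable_indicator borel_closed closed_Collect_le continuous_intros)
      have diff: "fock_integrand \<phi> (D n) z w - fock_integrand \<phi> F z w = fock_integrand \<phi> (\<lambda>w. D n w - F w) z w" for w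
        by (simp add: fock_integrand_def algebra_simps)
      have W: "cmod (?W w) \<le> \<delta> + 2 * C * ?I w" for w
      proof (cases "real N \<le> norm (w - z)")
        case True
        have "?W w = fock_weighted (D n) w - fock_weighted F w"
          by (simp add: fock_weighted_def algebra_simps)
        then have "cmod (?W w) \<le> C + C"
          using norm_triangle_ineq4[of "fock_weighted (D n) w" "fock_weighted F w"] DC[of n w] C[of w]
          by simp
        then show ?thesis
          using True pos(2) by simp
      next
        case False
        then have "w \<in> cball 0 L"
          using z norm_triangle_ineq[of "w - z" z] by (simp add: L_def)
        then have "cmod (D n w - F w) \<le> \<delta>"
          by (rule near[OF n])
        moreover have "cmod (?W w) \<le> cmod (D n w - F w)"
          unfolding fock_weighted_def norm_mult by (rule mult_left_le) simp_all
        ultimately show ?thesis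
          using False by simp
      qed
      have "ennreal (cmod (fock_op \<phi> (D n) z - fock_op \<phi> F z))
          = ennreal (cmod (LINT w|lborel. fock_integrand \<phi> (\<lambda>w. D n w - F w) z w))"
        using Bochner_Integration.integral_diff[OF int, of n z z]
        by (simp only: fock_op_lborel[OF \<phi> D(2)] fock_op_lborel[OF \<phi> F] diff)
      also have "\<dots> \<le> (\<integral>\<^sup>+w. ennreal (cmod (fock_integrand \<phi> (\<lambda>w. D n w - F w) z w)) \<partial>lborel)"
        using Bochner_Integration.integrable_diff[OF int, of n z z]
        by (intro integral_norm_bound_ennreal) (simp add: diff)
      also have "\<dots> \<le> (\<integral>\<^sup>+w. ennreal E * (ennreal \<delta> * ennreal (fock_kernel \<phi> z w)
          + ennreal (2 * C) * (ennreal (fock_kernel \<phi> z w) * indicator {w. real N \<le> norm (w - z)} w)) \<partial>lborel)"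
      proof (rule nn_integral_mono)
        fix w
        have "exp (pi * (norm z)\<^sup>2 / 2) \<le> E"
          using z by (simp add: E_def power_mono)
        then have "cmod (fock_integrand \<phi> (\<lambda>w. D n w - F w) z w)
            \<le> E * ((\<delta> + 2 * C * ?I w) * fock_kernel \<phi> z w)"
          unfolding norm_fock_integrand
          by (intro mult_mono mult_right_mono W fock_kernel_nonneg mult_nonneg_nonneg) (use pos in auto)
        then have "ennreal (cmod (fock_integrand \<phi> (\<lambda>w. D n w - F w) z w))
            \<le> ennreal (E * ((\<delta> + 2 * C * ?I w) * fock_kernel \<phi> z w))"
          by (rule ennreal_leI)
        also have "\<dots> = ennreal E * (ennreal \<delta> * ennreal (fock_kernel \<phi> z w)
          + ennreal (2 * C) * (ennreal (fock_kernel \<phi> z w) * indicator {w. real N \<le> norm (w - z)} w))"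
          using pos \<open>0 \<le> C\<close> fock_kernel_nonneg[of \<phi> z w]
          by (cases "real N \<le> norm (w - z)")
             (simp_all add: ennreal_mult ennreal_plus distrib_right)
        finally show "ennreal (cmod (fock_integrand \<phi> (\<lambda>w. D n w - F w) z w))
            \<le> ennreal E * (ennreal \<delta> * ennreal (fock_kernel \<phi> z w)
          + ennreal (2 * C) * (ennreal (fock_kernel \<phi> z w) * indicator {w. real N \<le> norm (w - z)} w))" .
      qed
      also have "\<dots> = ennreal E * (ennreal \<delta> * (\<integral>\<^sup>+w. ennreal (fock_kernel \<phi> z w) \<partial>lborel)
          + ennreal (2 * C) * (\<integral>\<^sup>+w. ennreal (fock_kernel \<phi> z w) * indicator {w. real N \<le> norm (w - z)} w \<partial>lborel))"
        by (simp add: nn_integral_cmult nn_integral_add)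
      also have "\<dots> \<le> ennreal E * (ennreal \<delta> * ennreal M + ennreal (2 * C) * ennreal \<eta>)"
        by (intro mult_left_mono add_mono M N) simp_all
      also have "\<dots> = ennreal (E * (\<delta> * M + 2 * C * \<eta>))"
        using pos M(1) \<open>0 \<le> C\<close> by (simp add: ennreal_mult ennreal_plus)
      also have "\<dots> \<le> ennreal e"
        using small by (rule ennreal_leI)
      finally show ?thesis
        using \<open>0 < e\<close> by (simp add: ennreal_le_iff)
    qed
    then show "\<forall>\<^sub>F n in sequentially. \<forall>z\<in>cball 0 R. cmod (fock_op \<phi> (D n) z - fock_op \<phi> F z) \<le> e"
      unfolding eventually_sequentially by blast
  qed
qed

section \<open>Boundedness on all Fock spaces\<close>

theorem theorem4p1:
  fixes \<phi> :: "complex ^ 'n \<Rightarrow> complex"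
    and H :: "complex ^ 'n \<Rightarrow> real"
  assumes "entire \<phi>"
    and "defines_fock_operator \<phi> 1 \<infinity>"
    and "integrable lebesgue H"
    and "\<And>z w. cmod (\<phi> (vcnj z - w)) \<le>
           cmod (exp (of_real (pi * ((norm z)\<^sup>2 + (norm w)\<^sup>2) / 2) - of_real pi * (w \<otimes>\<^sub>c vcnj z)))
             * H (z - w)"
  shows "\<forall>p. 1 \<le> p \<longrightarrow> bounded_on_fock \<phi> p"
proof (intro allI impI)
  fix p :: ennreal
  assume p: "1 \<le> p"
  have le: "fock_kernel \<phi> z w \<le> H (w - z)" for z w
    by (rule fock_kernel_le) (rule assms(4))
  note kernel_meas = fock_kernel_measurable[OF assms(1)]
  from fock_kernel_integrals[OF assms(1,3) le] obtain M where "0 < M"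
    and "\<forall>z. (\<integral>\<^sup>+w. ennreal (fock_kernel \<phi> z w) \<partial>lborel) \<le> ennreal M"
    and "\<forall>w. (\<integral>\<^sup>+z. ennreal (fock_kernel \<phi> z w) \<partial>lborel) \<le> ennreal M"
    by auto
  then have M: "0 < M"
    "\<And>z. (\<integral>\<^sup>+w. ennreal (fock_kernel \<phi> z w) \<partial>lborel) \<le> ennreal M"
    "\<And>w. (\<integral>\<^sup>+z. ennreal (fock_kernel \<phi> z w) \<partial>lborel) \<le> ennreal M"
    by simp_all
  have main: "(\<forall>z. integrable lebesgue (fock_integrand \<phi> F z)) \<and> fock_op \<phi> F \<in> fock_space p
      \<and> fock_norm p (fock_op \<phi> F) \<le> M * fock_norm p F" if F: "F \<in> fock_space p" for F
  proof -
    have F': "entire F" "fock_weighted F \<in> Lp_space p"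
      using F by (auto simp: fock_space_def)
    from fock_space_bounded[OF F p] obtain C where "\<forall>w. cmod (fock_weighted F w) \<le> C" ..
    note C = this[rule_format]
    have int: "integrable lborel (fock_integrand \<phi> F z)" for z
      by (rule fock_integrand_integrable[OF assms(1) F'(1) C M(2)])
    have ent: "entire (fock_op \<phi> F)"
    proof (rule fock_op_entire[OF assms(1,3) le _ F'(1) C])
      show "entire (fock_op \<phi> F)" if "F \<in> fock_space 1" for F
        using assms(2) that by (auto simp: defines_fock_operator_def fock_space_def)
    qed
    let ?f = "fock_weighted F" and ?g = "fock_weighted (fock_op \<phi> F)"
    have f_meas: "(\<lambda>w. cmod (?f w)) \<in> borel_measurable borel" and g_meas: "?g \<in> borel_measurable borel"
      by (intro borel_measurable_continuous_onI continuous_intros fock_weighted_continuous F' ent)+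
    have g_le: "ennreal (cmod (?g z)) \<le> (\<integral>\<^sup>+w. ennreal (cmod (?f w) * fock_kernel \<phi> z w) \<partial>lborel)" for z
      by (rule fock_op_pointwise_bound[OF assms(1) F'(1) int])
    have "?g \<in> Lp_space p \<and> Lp_norm p ?g \<le> M * Lp_norm p ?f"
    proof (cases "p = \<infinity>")
      case True
      show ?thesis
        using Lp_space_infinity_dominated[OF _ g_meas M(1,2) kernel_meas fock_kernel_nonneg g_le] F'(2) True
        by simp
    next
      case False
      then have r: "1 \<le> enn2real p"
        using p by (metis enn2real_mono enn2real_1 infinity_ennreal_def top.not_eq_extremum)
      show ?thesis
        by (rule Lp_space_finite_dominated[OF p False F'(2) g_meas M(1)],
            rule schur_test[OF f_meas kernel_meas _ fock_kernel_nonneg M r _ g_le]) simp_all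
    qed
    moreover have "integrable lebesgue (fock_integrand \<phi> F z)" for z
      using int[of z] fock_integrand_measurable[OF assms(1) F'(1)] by (simp add: integrable_completion)
    ultimately show ?thesis
      using ent by (simp add: fock_space_def fock_norm_def)
  qed
  then show "bounded_on_fock \<phi> p"
    unfolding bounded_on_fock_def defines_fock_operator_def by blast
qed

end
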